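(* Let $m=2k\ge4$ be an even integer, let $G=\langle s,t\mid \Pi(s,t,m)=\Pi(t,s,m)\rangle$ be the Artin group of type $I_2(m)$, let $M$ be the submonoid of $G$ generated by $\{s,t\}$, and let $\Delta=\Pi(s,t,m)=(st)^k=(ts)^k$. Let $G_1$ (resp. $M_1$) be the subgroup (resp. submonoid) generated by $t$ and let $H$ (resp. $N$) be the subgroup (resp. submonoid) generated by $s$. Let $r_1,\dots,r_{2k-1}$ be the standard generators of the braid group $\mathcal B_{2k}$ and let $\iota:G\to\mathcal B_{2k}$ be the (injective) homomorphism with $\iota(s)=\prod_{i=0}^{k-1}r_{2i+1}$ and $\iota(t)=\prod_{i=1}^{k-1}r_{2i}$. Let $\alpha\in G$. Then $\alpha$ is $(H,G_1)$-negative (with respect to the Garside structure $(G,M,\Delta)$) if and only if $\iota(\alpha)$ is $r_1$-negative.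
   Context: $\Pi(s,t,m)$ denotes the alternating word $sts\cdots$ of length $m$. The braid group is $\mathcal B_{2k}=\langle r_1,\dots,r_{2k-1}\mid r_ir_jr_i=r_jr_ir_j\text{ for }|i-j|=1,\ r_ir_j=r_jr_i\text{ for }|i-j|\ge2\rangle$. An element $\beta\in\mathcal B_{2k}$ is $r_1$-negative if it can be written $\beta=\beta_0r_1^{-1}\beta_1\cdots r_1^{-1}\beta_q$ with $q\ge1$ and $\beta_0,\dots,\beta_q\in\langle r_2,\dots,r_{2k-1}\rangle$. By a theorem of Crisp, $\iota$ is a well-defined injective homomorphism. For $\alpha,\beta\in G$: $\alpha\le_R\beta$ iff $\beta\alpha^{-1}\in M$. It is known that $(G,M,\Delta)$ is a Garside structure with $\Delta$ central in $G$, and that $(G_1,M_1,t)$ and $(H,N,s)$ are parabolic substructures of it. An element $a\in M$ is unmovable if $\Delta\not\le_R a$. Every $\alpha\in G$ is uniquely $\alpha=a\Delta^j$ with $a\in M$ unmovable and $j\in\mathbb Z$ (the $\Delta$-form of $\alpha$). Depth. For $K\in\{M_1,N\}$ and $a\in M$, $\tau_K(a)$ denotes the unique $b\in K$ with $\{c\in K\mid c\le_R a\}=\{c\in K\mid c\le_R b\}$. Every $a\in M\setminus\{1\}$ is uniquely $a=a_p\cdots a_2a_1$ with $a_p\ne1$, $a_i=\tau_{M_1}(a_p\cdots a_i)$ for $i$ odd and $a_i=\tau_N(a_p\cdots a_i)$ for $i$ even; set $\mathrm{bh}(a)=p$ and $\mathrm{bh}(1)=1$. The depth is $\mathrm{dpt}(a)=(\mathrm{bh}(a)-1)/2$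 if $\mathrm{bh}(a)$ is odd and $\mathrm{bh}(a)/2$ if $\mathrm{bh}(a)$ is even. An element $\alpha\in G$ with $\Delta$-form $\alpha=a\Delta^{-j}$ is $(H,G_1)$-negative if $j\ge1$ and $\mathrm{dpt}(a)<\mathrm{dpt}(\Delta^j)$. *)

theory Defs
  imports "HOL-Algebra.Generated_Groups"
begin

section \<open>Groups given by generators and relations\<close>

text \<open>A letter \<open>(x, True)\<close> stands for the generator \<open>x\<close>, a letter \<open>(x, False)\<close> for its
  formal inverse.\<close>

type_synonym 'a word = "('a \<times> bool) list"

abbreviation words :: "'a set \<Rightarrow> 'a word set" where
  "words S \<equiv> lists (S \<times> UNIV)"

definition positive_word :: "'a list \<Rightarrow> 'a word" where
  "positive_word xs = map (\<lambda>x. (x, True)) xs"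

inductive_set word_cong :: "'a set \<Rightarrow> ('a word \<times> 'a word) set \<Rightarrow> ('a word \<times> 'a word) set"
  for S :: "'a set" and R :: "('a word \<times> 'a word) set" where
  refl: "u \<in> words S \<Longrightarrow> (u, u) \<in> word_cong S R"
| sym: "(u, v) \<in> word_cong S R \<Longrightarrow> (v, u) \<in> word_cong S R"
| trans: "(u, v) \<in> word_cong S R \<Longrightarrow> (v, w) \<in> word_cong S R \<Longrightarrow> (u, w) \<in> word_cong S R"
| rel: "u \<in> words S \<Longrightarrow> v \<in> words S \<Longrightarrow> a \<in> words S \<Longrightarrow> b \<in> words S \<Longrightarrow> (a, b) \<in> R
    \<Longrightarrow> (u @ a @ v, u @ b @ v) \<in> word_cong S R"
| cancel: "u \<in> words S \<Longrightarrow> v \<in> words S \<Longrightarrow> x \<in> S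
    \<Longrightarrow> (u @ [(x, e), (x, \<not> e)] @ v, u @ v) \<in> word_cong S R"

definition word_class :: "'a set \<Rightarrow> ('a word \<times> 'a word) set \<Rightarrow> 'a word \<Rightarrow> 'a word set" where
  "word_class S R w = word_cong S R `` {w}"

definition presented_group :: "'a set \<Rightarrow> ('a word \<times> 'a word) set \<Rightarrow> 'a word set monoid" where
  "presented_group S R =
     \<lparr>carrier = words S // word_cong S R,
      monoid.mult = (\<lambda>A B. \<Union>a\<in>A. \<Union>b\<in>B. word_class S R (a @ b)),
      one = word_class S R []\<rparr>"

lemma word_cong_words: "(u, v) \<in> word_cong S R \<Longrightarrow> u \<in> words S \<and> v \<in> words S"
  by (induction rule: word_cong.induct) auto

lemma equiv_word_cong: "equiv (words S) (word_cong S R)"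
proof (rule equivI)
  show "word_cong S R \<subseteq> words S \<times> words S"
    by (rule subrelI) (drule word_cong_words, erule conjE, rule SigmaI)
  show "refl_on (words S) (word_cong S R)"
    by (rule refl_onI) (rule word_cong.refl)
  show "sym (word_cong S R)" by (rule symI) (rule word_cong.sym)
  show "trans (word_cong S R)" by (rule transI) (rule word_cong.trans)
qed

lemma word_cong_context:
  assumes "(u, v) \<in> word_cong S R" "p \<in> words S" "q \<in> words S"
  shows "(p @ u @ q, p @ v @ q) \<in> word_cong S R"
  using assms
proof (induction rule: word_cong.induct)
  case (refl u)
  then show ?case by (intro word_cong.refl) auto
next
  case (sym u v)
  then show ?case by (blast intro: word_cong.sym)
next
  case (trans u v w)
  from trans.IH trans.prems show ?case by (blast intro: word_cong.trans[of "p @ u @ q" "p @ v @ q"])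
next
  case (rel u v a b)
  then show ?case
    using word_cong.rel[of "p @ u" S "v @ q" a b R] by auto
next
  case (cancel u v x e)
  then show ?case
    using word_cong.cancel[of "p @ u" S "v @ q" x e R] by auto
qed

lemma word_cong_append:
  assumes "(a, a') \<in> word_cong S R" "(b, b') \<in> word_cong S R"
  shows "(a @ b, a' @ b') \<in> word_cong S R"
proof (rule word_cong.trans)
  show "(a @ b, a' @ b) \<in> word_cong S R"
    using word_cong_context[OF assms(1), of "[]" b] word_cong_words[OF assms(2)] by simp
  show "(a' @ b, a' @ b') \<in> word_cong S R"
    using word_cong_context[OF assms(2), of a' "[]"] word_cong_words[OF assms(1)] by simp
qed

lemma word_class_eq_iff:
  "u \<in> words S \<Longrightarrow> v \<in> words S
    \<Longrightarrow> word_class S R u = word_class S R v \<longleftrightarrow> (u, v) \<in> word_cong S R"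
  unfolding word_class_def using equiv_word_cong by (metis eq_equiv_class_iff)

lemma carrier_presented_group: "carrier (presented_group S R) = word_class S R ` words S"
  unfolding presented_group_def word_class_def quotient_def by auto

lemma one_presented_group: "\<one>\<^bsub>presented_group S R\<^esub> = word_class S R []"
  by (simp add: presented_group_def)

lemma mult_presented_group:
  assumes "u \<in> words S" "v \<in> words S"
  shows "word_class S R u \<otimes>\<^bsub>presented_group S R\<^esub> word_class S R v = word_class S R (u @ v)"
proof -
  have eq: "word_class S R (a @ b) = word_class S R (u @ v)"
    if "a \<in> word_class S R u" "b \<in> word_class S R v" for a b
  proof -
    have "(u, a) \<in> word_cong S R" "(v, b) \<in> word_cong S R"
      using that by (auto simp: word_class_def)
    then have "(u @ v, a @ b) \<in> word_cong S R" by (rule word_cong_append)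
    with word_cong_words[OF this] show ?thesis by (metis word_class_eq_iff)
  qed
  have "u \<in> word_class S R u" "v \<in> word_class S R v"
    using assms by (simp_all add: word_class_def word_cong.refl)
  with eq have "(\<Union>a\<in>word_class S R u. \<Union>b\<in>word_class S R v. word_class S R (a @ b)) =
      word_class S R (u @ v)" by blast
  then show ?thesis by (simp add: presented_group_def)
qed

definition inverse_word :: "'a word \<Rightarrow> 'a word" where
  "inverse_word w = rev (map (\<lambda>(x, e). (x, \<not> e)) w)"

lemma inverse_word_words: "w \<in> words S \<Longrightarrow> inverse_word w \<in> words S"
  by (auto simp: inverse_word_def)

lemma inverse_word_cancel:
  "w \<in> words S \<Longrightarrow> (inverse_word w @ w, []) \<in> word_cong S R"
proof (induction w)
  case Nil
  then show ?case by (auto simp: inverse_word_def intro: word_cong.refl)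
next
  case (Cons l w)
  obtain x e where l: "l = (x, e)" by force
  have w: "w \<in> words S" "x \<in> S" using Cons.prems l by auto
  have "(inverse_word w @ [(x, \<not> e), (x, \<not> \<not> e)] @ w, inverse_word w @ w) \<in> word_cong S R"
    using w inverse_word_words by (intro word_cong.cancel) auto
  then have "(inverse_word (l # w) @ l # w, inverse_word w @ w) \<in> word_cong S R"
    by (simp add: inverse_word_def l)
  then show ?case using Cons.IH[OF w(1)] by (rule word_cong.trans)
qed

lemma group_presented_group: "group (presented_group S R)"
proof (rule groupI)
  fix A assume "A \<in> carrier (presented_group S R)"
  then obtain w where w: "w \<in> words S" "A = word_class S R w"
    unfolding carrier_presented_group by blast
  have "word_class S R (inverse_word w @ w) = word_class S R []"
    using inverse_word_cancel[OF w(1), of R] word_cong_words word_class_eq_iff by metis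
  then have "word_class S R (inverse_word w) \<otimes>\<^bsub>presented_group S R\<^esub> A = \<one>\<^bsub>presented_group S R\<^esub>"
    using w inverse_word_words[OF w(1)] by (simp add: mult_presented_group one_presented_group)
  then show "\<exists>B\<in>carrier (presented_group S R). B \<otimes>\<^bsub>presented_group S R\<^esub> A = \<one>\<^bsub>presented_group S R\<^esub>"
    using inverse_word_words[OF w(1)] unfolding carrier_presented_group by blast
next
  fix A B assume "A \<in> carrier (presented_group S R)" "B \<in> carrier (presented_group S R)"
  then obtain u v where uv: "u \<in> words S" "A = word_class S R u" "v \<in> words S" "B = word_class S R v"
    unfolding carrier_presented_group by blast
  then have "u @ v \<in> words S" by simp
  with uv show "A \<otimes>\<^bsub>presented_group S R\<^esub> B \<in> carrier (presented_group S R)"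
    by (simp only: mult_presented_group carrier_presented_group imageI)
next
  show "\<one>\<^bsub>presented_group S R\<^esub> \<in> carrier (presented_group S R)"
    by (simp add: one_presented_group carrier_presented_group)
next
  fix A B C
  assume "A \<in> carrier (presented_group S R)" "B \<in> carrier (presented_group S R)"
    "C \<in> carrier (presented_group S R)"
  then obtain u v w where uvw: "u \<in> words S" "A = word_class S R u" "v \<in> words S"
    "B = word_class S R v" "w \<in> words S" "C = word_class S R w"
    unfolding carrier_presented_group by blast
  then have "u @ v \<in> words S" "v @ w \<in> words S" by simp_all
  with uvw show "A \<otimes>\<^bsub>presented_group S R\<^esub> B \<otimes>\<^bsub>presented_group S R\<^esub> C =
      A \<otimes>\<^bsub>presented_group S R\<^esub> (B \<otimes>\<^bsub>presented_group S R\<^esub> C)"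
    by (simp only: mult_presented_group append_assoc)
next
  fix A assume "A \<in> carrier (presented_group S R)"
  then obtain u where u: "u \<in> words S" "A = word_class S R u"
    unfolding carrier_presented_group by blast
  have "[] \<in> words S" by simp
  with u show "\<one>\<^bsub>presented_group S R\<^esub> \<otimes>\<^bsub>presented_group S R\<^esub> A = A"
    by (simp only: mult_presented_group one_presented_group append_Nil)
qed


section \<open>Products and generated submonoids\<close>

definition list_prod :: "('a, 'b) monoid_scheme \<Rightarrow> 'a list \<Rightarrow> 'a" where
  "list_prod G xs = foldr (\<lambda>x y. x \<otimes>\<^bsub>G\<^esub> y) xs \<one>\<^bsub>G\<^esub>"

inductive_set generate_monoid :: "('a, 'b) monoid_scheme \<Rightarrow> 'a set \<Rightarrow> 'a set"
  for G (structure) and A :: "'a set" where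
  one: "\<one> \<in> generate_monoid G A"
| incl: "x \<in> A \<Longrightarrow> x \<in> generate_monoid G A"
| mult: "x \<in> generate_monoid G A \<Longrightarrow> y \<in> generate_monoid G A \<Longrightarrow> x \<otimes> y \<in> generate_monoid G A"


section \<open>The Artin group of type \<open>I\<^sub>2(m)\<close>\<close>

datatype I2_gen = Gen_s | Gen_t

fun alternating :: "'a \<Rightarrow> 'a \<Rightarrow> nat \<Rightarrow> 'a list" where
  "alternating x y 0 = []"
| "alternating x y (Suc n) = x # alternating y x n"

definition artin_I2_rels :: "nat \<Rightarrow> (I2_gen word \<times> I2_gen word) set" where
  "artin_I2_rels m =
     {(positive_word (alternating Gen_s Gen_t m), positive_word (alternating Gen_t Gen_s m))}"

definition artin_I2 :: "nat \<Rightarrow> I2_gen word set monoid" where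
  "artin_I2 m = presented_group UNIV (artin_I2_rels m)"

definition artin_s :: "nat \<Rightarrow> I2_gen word set" where
  "artin_s m = word_class UNIV (artin_I2_rels m) (positive_word [Gen_s])"

definition artin_t :: "nat \<Rightarrow> I2_gen word set" where
  "artin_t m = word_class UNIV (artin_I2_rels m) (positive_word [Gen_t])"

definition artin_Delta :: "nat \<Rightarrow> I2_gen word set" where
  "artin_Delta m = list_prod (artin_I2 m) (alternating (artin_s m) (artin_t m) m)"

definition artin_M :: "nat \<Rightarrow> I2_gen word set set" where
  "artin_M m = generate_monoid (artin_I2 m) {artin_s m, artin_t m}"

definition artin_M1 :: "nat \<Rightarrow> I2_gen word set set" where
  "artin_M1 m = generate_monoid (artin_I2 m) {artin_t m}"

definition artin_N :: "nat \<Rightarrow> I2_gen word set set" where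
  "artin_N m = generate_monoid (artin_I2 m) {artin_s m}"


section \<open>Braid groups\<close>

text \<open>The generator \<open>r\<^sub>i\<close> is represented by its index.\<close>

definition braid_rels :: "nat \<Rightarrow> (nat word \<times> nat word) set" where
  "braid_rels n =
     {(positive_word [i, j, i], positive_word [j, i, j]) | i j.
        i \<in> {1..n - 1} \<and> j \<in> {1..n - 1} \<and> \<bar>int i - int j\<bar> = 1} \<union>
     {(positive_word [i, j], positive_word [j, i]) | i j.
        i \<in> {1..n - 1} \<and> j \<in> {1..n - 1} \<and> \<bar>int i - int j\<bar> \<ge> 2}"

definition braid_group :: "nat \<Rightarrow> nat word set monoid" where
  "braid_group n = presented_group {1..n - 1} (braid_rels n)"

definition braid_gen :: "nat \<Rightarrow> nat \<Rightarrow> nat word set" where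
  "braid_gen n i = word_class {1..n - 1} (braid_rels n) (positive_word [i])"

definition r1_negative :: "nat \<Rightarrow> nat word set \<Rightarrow> bool" where
  "r1_negative n \<beta> \<longleftrightarrow>
     (\<exists>q b. q \<ge> 1 \<and> (\<forall>i\<le>q. b i \<in> generate (braid_group n) (braid_gen n ` {2..n - 1})) \<and>
        \<beta> = b 0 \<otimes>\<^bsub>braid_group n\<^esub>
          list_prod (braid_group n)
            (map (\<lambda>i. inv\<^bsub>braid_group n\<^esub> (braid_gen n 1) \<otimes>\<^bsub>braid_group n\<^esub> b i) [1..<Suc q]))"


section \<open>Depth and negativity\<close>

text \<open>In this section \<open>M\<close> is the positive monoid of a Garside structure on \<open>G\<close> with central
  Garside element \<open>\<Delta>\<close>, and \<open>M1\<close>, \<open>N\<close> are the positive monoids of the parabolic substructures on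
  the subgroups \<open>G\<^sub>1\<close> and \<open>H\<close>. The subgroups enter the notions below only through \<open>M1\<close> and \<open>N\<close>.\<close>

definition le_R :: "('a, 'b) monoid_scheme \<Rightarrow> 'a set \<Rightarrow> 'a \<Rightarrow> 'a \<Rightarrow> bool" where
  "le_R G M \<alpha> \<beta> \<longleftrightarrow> \<beta> \<otimes>\<^bsub>G\<^esub> inv\<^bsub>G\<^esub> \<alpha> \<in> M"

definition tail :: "('a, 'b) monoid_scheme \<Rightarrow> 'a set \<Rightarrow> 'a set \<Rightarrow> 'a \<Rightarrow> 'a" where
  "tail G M K a = (THE b. b \<in> K \<and> {c \<in> K. le_R G M c a} = {c \<in> K. le_R G M c b})"

text \<open>\<open>x i\<close> is the factor \<open>a\<^sub>i\<close> of \<open>a = a\<^sub>p \<cdots> a\<^sub>2 a\<^sub>1\<close>.\<close>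

definition alternating_form ::
  "('a, 'b) monoid_scheme \<Rightarrow> 'a set \<Rightarrow> 'a set \<Rightarrow> 'a set \<Rightarrow> 'a \<Rightarrow> nat \<Rightarrow> (nat \<Rightarrow> 'a) \<Rightarrow> bool" where
  "alternating_form G M M1 N a p x \<longleftrightarrow>
     p \<ge> 1 \<and> (\<forall>i\<in>{1..p}. x i \<in> M) \<and> a = list_prod G (map x (rev [1..<Suc p])) \<and>
     x p \<noteq> \<one>\<^bsub>G\<^esub> \<and>
     (\<forall>i\<in>{1..p}. x i = tail G M (if odd i then M1 else N) (list_prod G (map x (rev [i..<Suc p]))))"

definition bh :: "('a, 'b) monoid_scheme \<Rightarrow> 'a set \<Rightarrow> 'a set \<Rightarrow> 'a set \<Rightarrow> 'a \<Rightarrow> nat" where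
  "bh G M M1 N a =
     (if a = \<one>\<^bsub>G\<^esub> then 1 else (THE p. \<exists>x. alternating_form G M M1 N a p x))"

definition dpt :: "('a, 'b) monoid_scheme \<Rightarrow> 'a set \<Rightarrow> 'a set \<Rightarrow> 'a set \<Rightarrow> 'a \<Rightarrow> nat" where
  "dpt G M M1 N a =
     (if odd (bh G M M1 N a) then (bh G M M1 N a - 1) div 2 else bh G M M1 N a div 2)"

definition unmovable :: "('a, 'b) monoid_scheme \<Rightarrow> 'a set \<Rightarrow> 'a \<Rightarrow> 'a \<Rightarrow> bool" where
  "unmovable G M \<Delta> a \<longleftrightarrow> a \<in> M \<and> \<not> le_R G M \<Delta> a"

definition Delta_form ::
  "('a, 'b) monoid_scheme \<Rightarrow> 'a set \<Rightarrow> 'a \<Rightarrow> 'a \<Rightarrow> 'a \<Rightarrow> int \<Rightarrow> bool" where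
  "Delta_form G M \<Delta> \<alpha> a j \<longleftrightarrow> unmovable G M \<Delta> a \<and> \<alpha> = a \<otimes>\<^bsub>G\<^esub> (\<Delta> [^]\<^bsub>G\<^esub> j)"

definition H_G1_negative ::
  "('a, 'b) monoid_scheme \<Rightarrow> 'a set \<Rightarrow> 'a \<Rightarrow> 'a set \<Rightarrow> 'a set \<Rightarrow> 'a \<Rightarrow> bool" where
  "H_G1_negative G M \<Delta> M1 N \<alpha> \<longleftrightarrow>
     (\<exists>a j. Delta_form G M \<Delta> \<alpha> a (- j) \<and> j \<ge> 1 \<and>
        dpt G M M1 N a < dpt G M M1 N (\<Delta> [^]\<^bsub>G\<^esub> j))"

end

theory Submission
  imports Defs Complex_Main
begin

text \<open>
  Write \<open>\<alpha> = a \<Delta>\<^bsup>-j\<^esup>\<close> with \<open>a\<close> unmovable. An unmovable \<open>a\<close> has a unique positive word, the depth of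
  \<open>a\<close> is its number \<open>d\<close> of \<open>s\<close>-blocks, and \<open>\<Delta>\<^sup>j\<close> has depth \<open>j (k - 1) + 1\<close>; so negativity means
  \<open>j \<ge> 1\<close> and \<open>d \<le> j (k - 1)\<close>.

  If a positive word \<open>c\<close> has at most \<open>k - 1\<close> \<open>s\<close>-blocks, then a light-cone argument puts \<open>\<iota>(c)\<close> into
  \<open>U V\<close> with \<open>U = \<langle>r\<^sub>2, \<dots>, r\<^bsub>2k-1\<^esub>\<rangle>\<close> and \<open>V = \<langle>r\<^sub>1, \<dots>, r\<^bsub>2k-2\<^esub>\<rangle>\<close>, and puts \<open>\<iota>(\<Delta>)\<close> into \<open>U \<delta> V\<close> with
  \<open>\<delta> = r\<^sub>1 r\<^sub>2 \<dots> r\<^bsub>2k-1\<^esub>\<close>. Since \<open>\<delta> V \<delta>\<^bsup>-1\<^esup> \<subseteq> U\<close>, the braid \<open>\<iota>(c \<Delta>\<^bsup>-1\<^esup>)\<close> contains a single \<open>r\<^sub>1\<^bsup>-1\<^esup>\<close>. As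
  \<open>\<Delta>\<close> is central, cutting \<open>a\<close> into \<open>j\<close> pieces shows that negative elements have \<open>r\<^sub>1\<close>-negative images.

  Conversely, \<open>a\<^bsup>-1\<^esup> = c \<Delta>\<^bsup>-l\<^esup>\<close> where the \<open>s\<close>-blocks of \<open>a\<close> and \<open>c\<close> add up to \<open>l (k - 1) + 1\<close>. So if
  \<open>\<alpha>\<close> is not negative, then \<open>\<iota>(\<alpha>)\<close> is positive, or lies in \<open>U\<close>, or has an \<open>r\<^sub>1\<close>-negative inverse. None of
  these braids is \<open>r\<^sub>1\<close>-negative: in the action of the braid group by Dynnikov's formulas, with maximum
  and addition replaced by addition and multiplication of positive reals, \<open>r\<^sub>1\<close> strictly increases the
  first coordinate while \<open>r\<^sub>2, r\<^sub>3, \<dots>\<close> fix it.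
\<close>

section \<open>Dynnikov's formulas over the positive reals\<close>

text \<open>Acts on two neighbouring pairs of coordinates. No subtraction occurs, so positive
  entries stay positive, and identities can be checked between polynomials instead of by cases on
  maxima.\<close>

definition dyn :: "(real \<times> real) \<times> (real \<times> real) \<Rightarrow> (real \<times> real) \<times> (real \<times> real)" where
  "dyn = (\<lambda>((a, b), (c, d)).
     ((a * (1 + b) + c * b, c * b * d / (c * b + a * (1 + b) * (1 + d))),
      (a * c * d / (a * (1 + d) + c), (c * b + a * (1 + b) * (1 + d)) / c)))"
text \<open>The mirror image of \<open>dyn\<close>: its conjugate by the map that inverts the first
  entry of each pair.\<close>

definition dyn_inv :: "(real \<times> real) \<times> (real \<times> real) \<Rightarrow> (real \<times> real) \<times> (real \<times> real)" where
  "dyn_inv = (\<lambda>((a, b), (c, d)).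
     ((a * c / (c * (1 + b) + a * b), a * b * d / (a * b + c * (1 + b) * (1 + d))),
      (c + (c + a) / d, (a * b + c * (1 + b) * (1 + d)) / a)))"

text \<open>Substitutes simplified closed forms for the three sums before any quotient is formed,
  which keeps composed fractions small.\<close>

lemma dyn_eq:
  assumes "a * (1 + b) + c * b = X" "c * b + a * (1 + b) * (1 + d) = Y" "a * (1 + d) + c = Z"
  shows "dyn ((a, b), (c, d)) = ((X, c * b * d / Y), (a * c * d / Z, Y / c))"
  using assms by (simp add: dyn_def)

lemma dyn_inv_eq:
  assumes "c * (1 + b) + a * b = X" "a * b + c * (1 + b) * (1 + d) = Y" "c + (c + a) / d = Z"
  shows "dyn_inv ((a, b), (c, d)) = ((a * c / X, a * b * d / Y), (Z, Y / a))"
  using assms by (simp add: dyn_inv_def)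

lemma dyn_inverse:
  assumes "a > 0" "b > 0" "c > 0" "d > 0"
  shows "dyn (dyn_inv ((a, b), (c, d))) = ((a, b), (c, d))"
    "dyn_inv (dyn ((a, b), (c, d))) = ((a, b), (c, d))"
proof -
  define N where "N = a * b + c * (1 + b) * (1 + d)"
  define N' where "N' = c * b + a * (1 + b) * (1 + d)"
  define A where "A = a * (1 + b) + c * b"
  define A' where "A' = c * (1 + b) + a * b"
  define C where "C = a * (1 + d) + c"
  define C' where "C' = c * (1 + d) + a"
  have nz: "N > 0" "N' > 0" "A > 0" "A' > 0" "C > 0" "C' > 0"
    unfolding N_def N'_def A_def A'_def C_def C'_def using assms by (auto intro!: add_pos_pos mult_pos_pos)
  have nz: "N \<noteq> 0" "N' \<noteq> 0" "A \<noteq> 0" "A' \<noteq> 0" "C \<noteq> 0" "C' \<noteq> 0" "a \<noteq> 0" "b \<noteq> 0" "c \<noteq> 0" "d \<noteq> 0"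
    using nz assms by linarith+
  \<comment> \<open>One plus each new second entry becomes a product over a common denominator;
    every sum below then reduces to one polynomial identity.\<close>
  have 1: "1 + a * b * d / N = (1 + d) * A' / N" "1 + N / a = (1 + b) * C' / a" "c + (c + a) / d = C' / d"
    "1 + c * b * d / N' = (1 + d) * A / N'" "1 + N' / c = (1 + b) * C / c"
    using nz by (simp_all add: field_simps) (simp_all add: N_def N'_def A_def A'_def C_def C'_def algebra_simps)
  show "dyn (dyn_inv ((a, b), (c, d))) = ((a, b), (c, d))"
  proof -
    have "a*c/A' * (1 + a*b*d/N) + C'/d * (a*b*d/N) = a * (c*(1+d) + b*C') / N"
      unfolding 1 using nz by (simp add: field_simps)
    moreover have "c*(1+d) + b*C' = N" by (simp add: N_def C'_def algebra_simps)
    ultimately have X: "a*c/A' * (1 + a*b*d/N) + C'/d * (a*b*d/N) = a" using nz by simp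
    have "C'/d * (a*b*d/N) + a*c/A' * (1 + a*b*d/N) * (1 + N/a) = C' * N / N"
      unfolding 1 using nz by (simp add: field_simps) (simp add: N_def algebra_simps)
    then have Y: "C'/d * (a*b*d/N) + a*c/A' * (1 + a*b*d/N) * (1 + N/a) = C'" using nz by simp
    have "a*c/A' * (1 + N/a) + C'/d = C' * (c*(1+b)*d + A') / (A' * d)"
      unfolding 1 using nz by (simp add: field_simps)
    moreover have "c*(1+b)*d + A' = N" by (simp add: N_def A'_def algebra_simps)
    ultimately have Z: "a*c/A' * (1 + N/a) + C'/d = C' * N / (A' * d)" by simp
    have "dyn_inv ((a, b), (c, d)) = ((a*c/A', a*b*d/N), (C'/d, N/a))"
      by (simp add: dyn_inv_def 1 flip: A'_def N_def)
    then show ?thesis using nz by (simp add: dyn_eq[OF X Y Z])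
  qed
  show "dyn_inv (dyn ((a, b), (c, d))) = ((a, b), (c, d))"
  proof -
    have "a*c*d/C * (1 + c*b*d/N') + A * (c*b*d/N') = A*c*d * (a*(1+d) + b*C) / (C * N')"
      unfolding 1 using nz by (simp add: field_simps)
    moreover have "a*(1+d) + b*C = N'" by (simp add: N'_def C_def algebra_simps)
    ultimately have X: "a*c*d/C * (1 + c*b*d/N') + A * (c*b*d/N') = A*c*d/C" using nz by simp
    have "A * (c*b*d/N') + a*c*d/C * (1 + c*b*d/N') * (1 + N'/c) = A*d * N' / N'"
      unfolding 1 using nz by (simp add: field_simps) (simp add: N'_def algebra_simps)
    then have Y: "A * (c*b*d/N') + a*c*d/C * (1 + c*b*d/N') * (1 + N'/c) = A*d" using nz by simp
    have "a*c*d/C + (a*c*d/C + A) / (N'/c) = c * (a*d*(N' + c) + A*C) / (C*N')"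
      using nz by (simp add: field_simps)
    moreover have "a*d*(N' + c) + A*C = C * N'" by (simp add: A_def N'_def C_def algebra_simps)
    ultimately have Z: "a*c*d/C + (a*c*d/C + A) / (N'/c) = c" using nz by simp
    have "dyn ((a, b), (c, d)) = ((A, c*b*d/N'), (a*c*d/C, N'/c))"
      by (rule dyn_eq) (simp_all add: A_def N'_def C_def)
    then show ?thesis using nz by (simp add: dyn_inv_eq[OF X Y Z])
  qed
qed

text \<open>The braid relation: equations 1 to 3 apply \<open>dyn\<close> at positions 12, 23, 12,
  equations 4 to 6 at 23, 12, 23. Both sides are computed in closed form over the same auxiliary
  positive polynomials, so that the results agree literally.\<close>

lemma dyn_braid:
  fixes a1 :: real
  assumes p: "a1>0" "b1>0" "a2>0" "b2>0" "a3>0" "b3>0"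
 and 1: "dyn ((a1,b1),(a2,b2)) = ((c1,d1),(c2,d2))"
 and 2: "dyn ((c2,d2),(a3,b3)) = ((e2,g2),(e3,g3))"
 and 3: "dyn ((c1,d1),(e2,g2)) = ((h1,i1),(h2,i2))"
 and 4: "dyn ((a2,b2),(a3,b3)) = ((j2,k2),(j3,k3))"
 and 5: "dyn ((a1,b1),(j2,k2)) = ((l1,m1),(l2,m2))"
 and 6: "dyn ((l2,m2),(j3,k3)) = ((n2,o2),(n3,o3))"
shows "h1 = l1 \<and> i1 = m1 \<and> h2 = n2 \<and> i2 = o2 \<and> e3 = n3 \<and> g3 = o3"
proof -
  define B1 B2 B3 where B: "B1 = 1 + b1" "B2 = 1 + b2" "B3 = 1 + b3"
  have B': "b1 = B1 - 1" "b2 = B2 - 1" "b3 = B3 - 1" by (simp_all add: B)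
  define A where "A = a1*B1 + a2*b1"
  define N where "N = a2*b1 + a1*B1*B2"
  define C where "C = a1*B2+a2"
  define A' where "A' = a2*B2 + a3*b2"
  define N' where "N' = a3*b2 + a2*B2*B3"
  define C' where "C' = a2*B3+a3"
  define P where "P = a1*a2*b2*B1 + a3*N"
  define Q where "Q = a3*N + a1*a2*b2*B1*B3"
  define S where "S = a1*a2*b2*B3 + a3*C"
  define T where "T = a1*B1 + b1*a2*B2+b1*b2*a3"
  define W where "W = b1*b2*a3 + B3*(a1*B1+a2*b1*B2)"
  define Y where "Y = a1*B3 + N'"
  note defs = A_def N_def C_def A'_def N'_def C'_def P_def Q_def S_def T_def W_def Y_def B
  have pos: "B1 > 0" "B2 > 0" "B3 > 0"
    using p by (auto simp: B)
  have pos: "B1 > 0" "B2 > 0" "B3 > 0" "N > 0" "C > 0" "N' > 0" "C' > 0" "A > 0" "A' > 0" "P > 0" "Q > 0" "S > 0" "T > 0" "W > 0" "Y > 0"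
    unfolding A_def N_def C_def A'_def N'_def C'_def P_def Q_def S_def T_def W_def Y_def using p pos by (auto intro!: add_pos_pos mult_pos_pos)
  then have nz: "B1 \<noteq> 0" "B2 \<noteq> 0" "B3 \<noteq> 0" "N \<noteq> 0" "C \<noteq> 0" "N' \<noteq> 0" "C' \<noteq> 0" "A \<noteq> 0" "A' \<noteq> 0" "P \<noteq> 0" "Q \<noteq> 0" "S \<noteq> 0" "T \<noteq> 0" "W \<noteq> 0" "Y \<noteq> 0"
    "a1 \<noteq> 0" "b1 \<noteq> 0" "a2 \<noteq> 0" "b2 \<noteq> 0" "a3 \<noteq> 0" "b3 \<noteq> 0" using p by linarith+
  have s1: "c1 = A" "d1 = a2*b1*b2/N" "c2 = a1*a2*b2/C" "d2 = N/a2"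
    using 1 by (auto simp: dyn_def A_def N_def C_def B)
  have D: "1 + d1 = B2*A/N" "1 + d2 = B1*C/a2"
    unfolding s1 using nz by (simp_all add: field_simps) (simp_all add: A_def N_def C_def B algebra_simps)
  have s2: "e2 = P/a2" "g2 = a3*N*b3/Q" "e3 = a1*a2*b2*a3*b3/S" "g3 = Q/(a2*a3)"
  proof -
    have "c2 * (1 + d2) + a3 * d2 = P / a2" "a3 * d2 + c2 * (1 + d2) * (1 + b3) = Q / a2"
      "c2 * (1 + b3) + a3 = S / C"
      unfolding D B(3)[symmetric] unfolding s1 using nz by (simp_all add: field_simps P_def Q_def S_def)
    from 2[unfolded dyn_eq[OF this]]
    show "e2 = P/a2" "g2 = a3*N*b3/Q" "e3 = a1*a2*b2*a3*b3/S" "g3 = Q/(a2*a3)"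
      using nz by (auto simp: s1)
  qed
  have G: "1 + g2 = B3*P/Q"
    unfolding s2 using nz by (simp add: field_simps) (simp add: P_def Q_def B algebra_simps)
  \<comment> \<open>These factorisations expose the factor \<open>N\<close> introduced by the first
    application, so that it cancels in the third.\<close>
  have AN: "A*A*B2 + P*b1*b2 = N*T" "b1*b2*Q + A*A*B2*B3 = N*W" "a2*A*B3 + Q = N*C'"
    unfolding defs by algebra+
  have s3: "h1 = T" "i1 = b1*b2*a3*b3/W" "h2 = A*a3*b3/C'" "i2 = a2*W/Q"
  proof -
    have "c1 * (1 + d1) + e2 * d1 = (A*A*B2 + P*b1*b2) / N" 
      unfolding D unfolding s1 s2 using nz by (simp add: field_simps)
    then have 31: "c1 * (1 + d1) + e2 * d1 = T" using nz by (simp add: AN)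
    have "e2 * d1 + c1 * (1 + d1) * (1 + g2) = P * (b1*b2*Q + A*A*B2*B3) / (N * Q)"
      unfolding D G unfolding s1 s2 using nz by (simp add: field_simps)
    then have 32: "e2 * d1 + c1 * (1 + d1) * (1 + g2) = P * W / Q" using nz by (simp add: AN)
    have "c1 * (1 + g2) + e2 = P * (a2*A*B3 + Q) / (a2*Q)"
      unfolding G unfolding s1 s2 using nz by (simp add: field_simps)
    then have 33: "c1 * (1 + g2) + e2 = P * (N * C') / (a2*Q)" using nz by (simp add: AN)
    show "h1 = T" "i1 = b1*b2*a3*b3/W" "h2 = A*a3*b3/C'" "i2 = a2*W/Q"
      using 3[unfolded dyn_eq[OF 31 32 33]] nz by (auto simp: s1 s2)
  qed
  have s4: "j2 = A'" "k2 = a3*b2*b3/N'" "j3 = a2*a3*b3/C'" "k3 = N'/a3"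
    using 4 by (auto simp: dyn_def A'_def N'_def C'_def B)
  have K: "1 + k2 = B3*A'/N'" "1 + k3 = B2*C'/a3"
    unfolding s4 using nz by (simp_all add: field_simps) (simp_all add: A'_def N'_def C'_def B algebra_simps)
  have NN: "b1*N' + a1*B1*B3 = W" "A'*b1 + a1*B1 = T" 
    "a1*b2*B1*C' + a2*W = A*N'" "a2*a3*W + a1*b2*B1*B2*C'*C' = Q*N'"
    "a1*b2*B2*C'*C' + a2*a3*Y = S*N'"
    unfolding defs by algebra+
  have s5: "l1 = T" "m1 = b1*b2*a3*b3/W" "l2 = a1*a3*b2*b3/Y" "m2 = W/N'"
  proof -
    have 50: "a1 * (1 + b1) + j2 * b1 = T"
      unfolding s4 B(1)[symmetric] NN(2)[symmetric] by simp
    have "j2 * b1 + a1 * (1 + b1) * (1 + k2) = A' * (b1*N' + a1*B1*B3) / N'"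
      unfolding K unfolding s4 B(1)[symmetric] using nz by (simp add: field_simps)
    then have 51: "j2 * b1 + a1 * (1 + b1) * (1 + k2) = A' * W / N'" by (simp add: NN)
    have 52: "a1 * (1 + k2) + j2 = A' * Y / N'"
      unfolding K unfolding s4 Y_def using nz by (simp add: field_simps)
    show "l1 = T" "m1 = b1*b2*a3*b3/W" "l2 = a1*a3*b2*b3/Y" "m2 = W/N'"
      using 5[unfolded dyn_eq[OF 50 51 52]] nz by (auto simp: s4)
  qed
  have M: "1 + m2 = B1*Y/N'"
    unfolding s5 using nz by (simp add: field_simps) (simp add: defs algebra_simps)
  have s6: "n2 = A*a3*b3/C'" "o2 = a2*W/Q" "n3 = a1*a2*b2*a3*b3/S" "o3 = Q/(a2*a3)"
  proof -
    have "l2 * (1 + m2) + j3 * m2 = a3*b3*(a1*b2*B1*C' + a2*W) / (N'*C')"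
      unfolding M unfolding s4 s5 using nz by (simp add: field_simps)
    then have 61: "l2 * (1 + m2) + j3 * m2 = A*a3*b3/C'" using nz by (simp add: NN)
    have "j3 * m2 + l2 * (1 + m2) * (1 + k3) = b3 * (a2*a3*W + a1*b2*B1*B2*C'*C') / (N'*C')"
      unfolding M K unfolding s4 s5 using nz by (simp add: field_simps)
    then have 62: "j3 * m2 + l2 * (1 + m2) * (1 + k3) = b3 * Q / C'" using nz by (simp add: NN)
    have "l2 * (1 + k3) + j3 = b3 * (a1*b2*B2*C'*C' + a2*a3*Y) / (Y*C')"
      unfolding K unfolding s4 s5 using nz by (simp add: field_simps)
    then have 63: "l2 * (1 + k3) + j3 = b3 * (S*N') / (Y*C')" using nz by (simp add: NN)
    show "n2 = A*a3*b3/C'" "o2 = a2*W/Q" "n3 = a1*a2*b2*a3*b3/S" "o3 = Q/(a2*a3)"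
      using 6[unfolded dyn_eq[OF 61 62 63]] nz by (auto simp: s4 s5)
  qed
  show ?thesis by (simp add: s2 s3 s5 s6)
qed

section \<open>Actions of presented groups\<close>

text \<open>\<open>fold\<close> reads a word from its left end, so this yields a right action of the
  presented group. \<open>X\<close> confines the cancellation law and the relations to admissible
  states.\<close>

locale word_action =
  fixes S :: "'a set" and R :: "('a word \<times> 'a word) set"
    and f :: "'a \<times> bool \<Rightarrow> 'x \<Rightarrow> 'x" and X :: "'x set"
  assumes step_closed: "g \<in> S \<Longrightarrow> x \<in> X \<Longrightarrow> f (g, e) x \<in> X"
    and step_cancel: "g \<in> S \<Longrightarrow> x \<in> X \<Longrightarrow> f (g, \<not> e) (f (g, e) x) = x"
    and rel_fold: "(a, b) \<in> R \<Longrightarrow> a \<in> words S \<Longrightarrow> b \<in> words S \<Longrightarrow> x \<in> X \<Longrightarrow> fold f a x = fold f b x"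
begin

lemma fold_closed: "w \<in> words S \<Longrightarrow> x \<in> X \<Longrightarrow> fold f w x \<in> X"
  by (induction w arbitrary: x) (auto intro: step_closed)

lemma word_cong_fold: "(u, v) \<in> word_cong S R \<Longrightarrow> x \<in> X \<Longrightarrow> fold f u x = fold f v x"
proof (induction arbitrary: x rule: word_cong.induct)
  case (rel u v a b)
  then show ?case using rel_fold[of a b] fold_closed by simp
next
  case (cancel u v g e)
  then show ?case using step_cancel[of g] fold_closed by simp
qed auto

definition act :: "'a word set \<Rightarrow> 'x \<Rightarrow> 'x" where
  "act A = fold f (SOME w. w \<in> A)"

lemma act_word_class:
  assumes "w \<in> words S" "x \<in> X"
  shows "act (word_class S R w) x = fold f w x"
proof -
  have "w \<in> word_class S R w" using assms by (simp add: word_class_def word_cong.refl)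
  then have "(SOME v. v \<in> word_class S R w) \<in> word_class S R w" by (rule someI)
  then have "(w, SOME v. v \<in> word_class S R w) \<in> word_cong S R" by (simp add: word_class_def)
  from word_cong_fold[OF this assms(2)] show ?thesis by (simp add: act_def)
qed

lemma act_closed: "A \<in> carrier (presented_group S R) \<Longrightarrow> x \<in> X \<Longrightarrow> act A x \<in> X"
  unfolding carrier_presented_group by (elim imageE) (simp only: act_word_class fold_closed)

lemma act_one: "x \<in> X \<Longrightarrow> act \<one>\<^bsub>presented_group S R\<^esub> x = x"
  using act_word_class[of "[]" x] by (simp add: one_presented_group)

lemma act_mult:
  assumes "A \<in> carrier (presented_group S R)" "B \<in> carrier (presented_group S R)" "x \<in> X"
  shows "act (A \<otimes>\<^bsub>presented_group S R\<^esub> B) x = act B (act A x)"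
proof -
  obtain u v where "u \<in> words S" "A = word_class S R u" "v \<in> words S" "B = word_class S R v"
    using assms unfolding carrier_presented_group by blast
  moreover then have "u @ v \<in> words S" by simp
  ultimately show ?thesis
    using assms(3) act_word_class[of "u @ v"] by (simp add: mult_presented_group act_word_class fold_closed)
qed

lemma act_inv:
  assumes "A \<in> carrier (presented_group S R)" "x \<in> X"
  shows "act (inv\<^bsub>presented_group S R\<^esub> A) (act A x) = x"
    and "act A (act (inv\<^bsub>presented_group S R\<^esub> A) x) = x"
proof -
  interpret group "presented_group S R" by (rule group_presented_group)
  show "act (inv\<^bsub>presented_group S R\<^esub> A) (act A x) = x" "act A (act (inv\<^bsub>presented_group S R\<^esub> A) x) = x"
    using assms act_one by (simp_all flip: act_mult)
qed

end

section \<open>The Dynnikov action of the braid group\<close>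

definition dyn_step :: "nat \<times> bool \<Rightarrow> (nat \<Rightarrow> real \<times> real) \<Rightarrow> nat \<Rightarrow> real \<times> real" where
  "dyn_step = (\<lambda>(i, e) x. let p = (if e then dyn else dyn_inv) (x i, x (Suc i))
     in x(i := fst p, Suc i := snd p))"

definition dyn_states :: "(nat \<Rightarrow> real \<times> real) set" where
  "dyn_states = {x. \<forall>i. fst (x i) > 0 \<and> snd (x i) > 0}"

lemma dyn_step_braid:
  assumes "x \<in> dyn_states"
  shows "dyn_step (i, True) (dyn_step (Suc i, True) (dyn_step (i, True) x)) =
    dyn_step (Suc i, True) (dyn_step (i, True) (dyn_step (Suc i, True) x))"
proof -
  obtain a1 b1 where 1: "x i = (a1, b1)" by force
  obtain a2 b2 where 2: "x (Suc i) = (a2, b2)" by force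
  obtain a3 b3 where 3: "x (Suc (Suc i)) = (a3, b3)" by force
  have p: "a1 > 0" "b1 > 0" "a2 > 0" "b2 > 0" "a3 > 0" "b3 > 0"
    using assms 1 2 3 unfolding dyn_states_def mem_Collect_eq by (metis fst_conv snd_conv)+
  obtain c1 d1 c2 d2 where s1: "dyn ((a1,b1),(a2,b2)) = ((c1,d1),(c2,d2))" by (metis prod.exhaust)
  obtain e2 g2 e3 g3 where s2: "dyn ((c2,d2),(a3,b3)) = ((e2,g2),(e3,g3))" by (metis prod.exhaust)
  obtain h1 i1 h2 i2 where s3: "dyn ((c1,d1),(e2,g2)) = ((h1,i1),(h2,i2))" by (metis prod.exhaust)
  obtain j2 k2 j3 k3 where s4: "dyn ((a2,b2),(a3,b3)) = ((j2,k2),(j3,k3))" by (metis prod.exhaust)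
  obtain l1 m1 l2 m2 where s5: "dyn ((a1,b1),(j2,k2)) = ((l1,m1),(l2,m2))" by (metis prod.exhaust)
  obtain n2 o2 n3 o3 where s6: "dyn ((l2,m2),(j3,k3)) = ((n2,o2),(n3,o3))" by (metis prod.exhaust)
  show ?thesis
    using dyn_braid[OF p s1 s2 s3 s4 s5 s6]
    by (auto simp: dyn_step_def Let_def fun_eq_iff 1 2 3 s1 s2 s3 s4 s5 s6)
qed

lemma dyn_step_commute:
  "\<bar>int i - int j\<bar> \<ge> 2 \<Longrightarrow> dyn_step (i, True) (dyn_step (j, True) x) = dyn_step (j, True) (dyn_step (i, True) x)"
  by (auto simp: dyn_step_def Let_def fun_eq_iff)

text \<open>The new entry is \<open>a + a * b + c * b\<close> with all entries positive. This strict
  growth is what separates r_1 from the other generators.\<close>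

lemma fst_dyn_step_1:
  assumes "x \<in> dyn_states"
  shows "fst (dyn_step (Suc 0, True) x (Suc 0)) > fst (x (Suc 0))"
proof -
  obtain a b where 1: "x (Suc 0) = (a, b)" by force
  obtain c d where 2: "x (Suc (Suc 0)) = (c, d)" by force
  have p: "a > 0" "b > 0" "c > 0"
    using assms 1 2 unfolding dyn_states_def mem_Collect_eq by (metis fst_conv snd_conv)+
  then have "a * b > 0" "c * b > 0" by simp_all
  then show ?thesis by (simp add: dyn_step_def dyn_def Let_def 1 2 algebra_simps)
qed

lemma dyn_step_other: "j \<noteq> i \<Longrightarrow> j \<noteq> Suc i \<Longrightarrow> dyn_step (i, e) x j = x j"
  by (simp add: dyn_step_def Let_def)

interpretation braid: word_action "{1..n - 1}" "braid_rels n" dyn_step dyn_states for n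
proof
  fix i e and x :: "nat \<Rightarrow> real \<times> real"
  assume x: "x \<in> dyn_states"
  obtain a b where 1: "x i = (a, b)" by force
  obtain c d where 2: "x (Suc i) = (c, d)" by force
  have p: "a > 0" "b > 0" "c > 0" "d > 0"
    using x 1 2 unfolding dyn_states_def mem_Collect_eq by (metis fst_conv snd_conv)+
  show "dyn_step (i, e) x \<in> dyn_states"
    using x p by (auto simp: dyn_states_def dyn_step_def Let_def 1 2 dyn_def dyn_inv_def
      intro!: divide_pos_pos add_pos_pos mult_pos_pos)
  have "\<And>y. y(i := (a, b), Suc i := (c, d)) = y \<longleftrightarrow> y i = (a, b) \<and> y (Suc i) = (c, d)"
    by (auto simp: fun_eq_iff)
  then show "dyn_step (i, \<not> e) (dyn_step (i, e) x) = x"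
    using dyn_inverse[OF p] by (cases e) (auto simp: dyn_step_def Let_def 1 2 fun_eq_iff)
next
  fix a b x assume "(a, b) \<in> braid_rels n" and x: "x \<in> dyn_states"
  then consider i j where "a = positive_word [i, j, i]" "b = positive_word [j, i, j]" "\<bar>int i - int j\<bar> = 1"
    | i j where "a = positive_word [i, j]" "b = positive_word [j, i]" "\<bar>int i - int j\<bar> \<ge> 2"
    unfolding braid_rels_def by blast
  then show "fold dyn_step a x = fold dyn_step b x"
  proof cases
    case 1
    then have "j = Suc i \<or> i = Suc j" by linarith
    then show ?thesis using 1 dyn_step_braid[OF x] by (auto simp: positive_word_def)
  next
    case 2
    then show ?thesis using dyn_step_commute[of i j x] by (simp add: positive_word_def)
  qed
qed

section \<open>Subgroups of the braid group and \<open>r\<^sub>1\<close>-negative braids\<close>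

lemma list_prod_Nil [simp]: "list_prod G [] = \<one>\<^bsub>G\<^esub>"
  and list_prod_Cons [simp]: "list_prod G (x # xs) = x \<otimes>\<^bsub>G\<^esub> list_prod G xs"
  by (simp_all add: list_prod_def)

context group
begin

lemma list_prod_closed [simp]: "set xs \<subseteq> carrier G \<Longrightarrow> list_prod G xs \<in> carrier G"
  by (induction xs) auto

lemma list_prod_append:
  "set xs \<subseteq> carrier G \<Longrightarrow> set ys \<subseteq> carrier G \<Longrightarrow> list_prod G (xs @ ys) = list_prod G xs \<otimes> list_prod G ys"
  by (induction xs) (auto simp: m_assoc)

lemma inv_cancel_left:
  "x \<in> carrier G \<Longrightarrow> y \<in> carrier G \<Longrightarrow> inv x \<otimes> (x \<otimes> y) = y"
  "x \<in> carrier G \<Longrightarrow> y \<in> carrier G \<Longrightarrow> x \<otimes> (inv x \<otimes> y) = y"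
  by (simp_all flip: m_assoc)

lemma commute_inv:
  assumes "x \<in> carrier G" "y \<in> carrier G" "x \<otimes> y = y \<otimes> x"
  shows "x \<otimes> inv y = inv y \<otimes> x"
  using assms by (metis inv_closed inv_solve_left inv_solve_right m_assoc m_closed)

lemma commute_generate:
  assumes "x \<in> carrier G" "K \<subseteq> carrier G" "\<And>y. y \<in> K \<Longrightarrow> x \<otimes> y = y \<otimes> x" "b \<in> generate G K"
  shows "x \<otimes> b = b \<otimes> x"
  using assms(4)
proof (induction rule: generate.induct)
  case one
  then show ?case using assms(1) by simp
next
  case (incl h)
  then show ?case by (rule assms(3))
next
  case (inv h)
  then show ?case using assms by (intro commute_inv) auto
next
  case (eng h1 h2)
  then have "h1 \<in> carrier G" "h2 \<in> carrier G" using generate_in_carrier assms(2) by blast+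
  with eng assms(1) show ?case by (metis m_assoc)
qed

lemma generate_commute:
  assumes "H \<subseteq> carrier G" "K \<subseteq> carrier G" "\<And>x y. x \<in> H \<Longrightarrow> y \<in> K \<Longrightarrow> x \<otimes> y = y \<otimes> x"
    and "a \<in> generate G H" "b \<in> generate G K"
  shows "a \<otimes> b = b \<otimes> a"
proof (rule commute_generate[OF _ assms(2) _ assms(5)])
  show "a \<in> carrier G" using generate_in_carrier assms by blast
  show "a \<otimes> y = y \<otimes> a" if "y \<in> K" for y
    using commute_generate[of y H a] assms that by (metis subsetD)
qed

lemma conjugate_generate:
  assumes x: "x \<in> carrier G" and K: "K \<subseteq> carrier G" and "subgroup H G"
    and "\<And>y. y \<in> K \<Longrightarrow> x \<otimes> y \<otimes> inv x \<in> H" and "b \<in> generate G K"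
  shows "x \<otimes> b \<otimes> inv x \<in> H"
  using assms(5)
proof (induction rule: generate.induct)
  case one
  then show ?case using x subgroup.one_closed[OF assms(3)] by simp
next
  case (incl h)
  then show ?case by (rule assms(4))
next
  case (inv h)
  then have h: "h \<in> carrier G" using K by blast
  have "inv (x \<otimes> h \<otimes> inv x) \<in> H"
    using subgroup.m_inv_closed[OF assms(3) assms(4)[OF inv]] .
  then show ?case using x h by (simp add: inv_mult_group m_assoc)
next
  case (eng h1 h2)
  then have h: "h1 \<in> carrier G" "h2 \<in> carrier G" using generate_in_carrier assms(2) by blast+
  have "(x \<otimes> h1 \<otimes> inv x) \<otimes> (x \<otimes> h2 \<otimes> inv x) = x \<otimes> (h1 \<otimes> h2) \<otimes> inv x"
    using h x by (simp add: m_assoc inv_cancel_left)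
  with subgroup.m_closed[OF assms(3) eng.IH] show ?case by (simp only:)
qed

end

section \<open>Standard parabolic subgroups of the braid group\<close>

definition braid_sub :: "nat \<Rightarrow> nat set \<Rightarrow> nat word set set" where
  "braid_sub n I = generate (braid_group n) (braid_gen n ` I)"

lemma group_braid_group: "group (braid_group n)"
  unfolding braid_group_def by (rule group_presented_group)

interpretation braid: group "braid_group n" for n
  by (rule group_braid_group)

lemma positive_word_words: "set xs \<subseteq> S \<Longrightarrow> positive_word xs \<in> words S"
  by (auto simp: positive_word_def)

lemma positive_word_append: "positive_word (xs @ ys) = positive_word xs @ positive_word ys"
  by (simp add: positive_word_def)

lemma braid_gen_closed: "i \<in> {1..n - 1} \<Longrightarrow> braid_gen n i \<in> carrier (braid_group n)"
  unfolding braid_gen_def braid_group_def carrier_presented_group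
  by (intro imageI positive_word_words) auto

lemma braid_gen_list_closed:
  "set is \<subseteq> {1..n - 1} \<Longrightarrow> list_prod (braid_group n) (map (braid_gen n) is) \<in> carrier (braid_group n)"
  by (intro braid.list_prod_closed, unfold set_map) (use braid_gen_closed in blast)

lemma braid_gen_word:
  "set is \<subseteq> {1..n - 1} \<Longrightarrow> list_prod (braid_group n) (map (braid_gen n) is) =
    word_class {1..n - 1} (braid_rels n) (positive_word is)"
proof (induction "is")
  case Nil
  then show ?case by (simp add: braid_group_def one_presented_group positive_word_def)
next
  case (Cons i "is")
  then have "positive_word [i] \<in> words {1..n - 1}" "positive_word is \<in> words {1..n - 1}"
    by (intro positive_word_words; simp)+
  from mult_presented_group[OF this, of "braid_rels n"] Cons show ?case
    by (simp add: braid_gen_def braid_group_def flip: positive_word_append)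
qed

lemma braid_gen_rel:
  assumes "(positive_word is, positive_word js) \<in> braid_rels n" "set is \<subseteq> {1..n - 1}" "set js \<subseteq> {1..n - 1}"
  shows "list_prod (braid_group n) (map (braid_gen n) is) = list_prod (braid_group n) (map (braid_gen n) js)"
proof -
  note w = assms(2,3)[THEN positive_word_words]
  have "(positive_word is, positive_word js) \<in> word_cong {1..n - 1} (braid_rels n)"
    using word_cong.rel[of "[]" "{1..n - 1}" "[]", OF _ _ w assms(1)] by simp
  then show ?thesis using w assms(2,3) by (simp add: braid_gen_word word_class_eq_iff)
qed

lemma braid_gen_braid:
  assumes "i \<in> {1..n - 1}" "Suc i \<in> {1..n - 1}"
  shows "braid_gen n i \<otimes>\<^bsub>braid_group n\<^esub> (braid_gen n (Suc i) \<otimes>\<^bsub>braid_group n\<^esub> braid_gen n i) =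
    braid_gen n (Suc i) \<otimes>\<^bsub>braid_group n\<^esub> (braid_gen n i \<otimes>\<^bsub>braid_group n\<^esub> braid_gen n (Suc i))"
proof -
  have "(positive_word [i, Suc i, i], positive_word [Suc i, i, Suc i]) \<in> braid_rels n"
    unfolding braid_rels_def using assms by fastforce
  from braid_gen_rel[OF this] show ?thesis using assms by (simp add: braid_gen_closed)
qed

lemma braid_gen_commute:
  assumes "i \<in> {1..n - 1}" "j \<in> {1..n - 1}" "\<bar>int i - int j\<bar> \<ge> 2"
  shows "braid_gen n i \<otimes>\<^bsub>braid_group n\<^esub> braid_gen n j = braid_gen n j \<otimes>\<^bsub>braid_group n\<^esub> braid_gen n i"
proof -
  have "(positive_word [i, j], positive_word [j, i]) \<in> braid_rels n"
    unfolding braid_rels_def using assms by blast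
  from braid_gen_rel[OF this] show ?thesis using assms by (simp add: braid_gen_closed)
qed

lemma braid_sub_subgroup: "I \<subseteq> {1..n - 1} \<Longrightarrow> subgroup (braid_sub n I) (braid_group n)"
  unfolding braid_sub_def by (intro braid.generate_is_subgroup) (use braid_gen_closed in blast)

lemma braid_sub_mono: "I \<subseteq> J \<Longrightarrow> braid_sub n I \<subseteq> braid_sub n J"
  unfolding braid_sub_def by (intro braid.mono_generate image_mono)

lemma braid_sub_gen: "i \<in> I \<Longrightarrow> braid_gen n i \<in> braid_sub n I"
  unfolding braid_sub_def by (intro generate.incl imageI)

lemma braid_sub_commute:
  assumes "I \<subseteq> {1..n - 1}" "J \<subseteq> {1..n - 1}" "\<And>i j. i \<in> I \<Longrightarrow> j \<in> J \<Longrightarrow> i + 2 \<le> j"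
    and "a \<in> braid_sub n I" "b \<in> braid_sub n J"
  shows "a \<otimes>\<^bsub>braid_group n\<^esub> b = b \<otimes>\<^bsub>braid_group n\<^esub> a"
proof (rule braid.generate_commute[OF _ _ _ assms(4,5)[unfolded braid_sub_def]])
  show "braid_gen n ` I \<subseteq> carrier (braid_group n)" "braid_gen n ` J \<subseteq> carrier (braid_group n)"
    using assms braid_gen_closed by blast+
  fix x y assume "x \<in> braid_gen n ` I" "y \<in> braid_gen n ` J"
  then obtain i j where ij: "x = braid_gen n i" "i \<in> I" "y = braid_gen n j" "j \<in> J" by blast
  with assms(3) have "\<bar>int i - int j\<bar> \<ge> 2" by force
  then show "x \<otimes>\<^bsub>braid_group n\<^esub> y = y \<otimes>\<^bsub>braid_group n\<^esub> x"
    using ij assms braid_gen_commute by blast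
qed

section \<open>r_1-negative braids and the first Dynnikov coordinate\<close>

lemmas braid_act_closed = braid.act_closed[folded braid_group_def]
  and braid_act_one = braid.act_one[folded braid_group_def]
  and braid_act_mult = braid.act_mult[folded braid_group_def]
  and braid_act_inv = braid.act_inv[folded braid_group_def]

text \<open>Listing the factors that follow each r_1^{-1} makes concatenation and induction
  available; non-emptiness of the list is the condition q >= 1.\<close>

lemma r1_negative_iff:
  "r1_negative n \<beta> \<longleftrightarrow> (\<exists>u ys. u \<in> braid_sub n {2..n - 1} \<and> ys \<noteq> [] \<and> set ys \<subseteq> braid_sub n {2..n - 1} \<and>
     \<beta> = u \<otimes>\<^bsub>braid_group n\<^esub> list_prod (braid_group n)
       (map (\<lambda>y. inv\<^bsub>braid_group n\<^esub> (braid_gen n 1) \<otimes>\<^bsub>braid_group n\<^esub> y) ys))"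
  (is "_ \<longleftrightarrow> (\<exists>u ys. ?P u ys)")
proof
  assume "r1_negative n \<beta>"
  then obtain q b where qb: "q \<ge> 1" "\<forall>i\<le>q. b i \<in> braid_sub n {2..n - 1}"
    "\<beta> = b 0 \<otimes>\<^bsub>braid_group n\<^esub> list_prod (braid_group n)
      (map (\<lambda>i. inv\<^bsub>braid_group n\<^esub> (braid_gen n 1) \<otimes>\<^bsub>braid_group n\<^esub> b i) [1..<Suc q])"
    unfolding r1_negative_def braid_sub_def by blast
  then have "?P (b 0) (map b [1..<Suc q])" by (auto simp: o_def)
  then show "\<exists>u ys. ?P u ys" by blast
next
  assume "\<exists>u ys. ?P u ys"
  then obtain u ys where P: "?P u ys" by blast
  let ?b = "\<lambda>i. (u # ys) ! i"
  have "map (\<lambda>i. inv\<^bsub>braid_group n\<^esub> (braid_gen n 1) \<otimes>\<^bsub>braid_group n\<^esub> ?b i) [1..<Suc (length ys)] =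
     map (\<lambda>y. inv\<^bsub>braid_group n\<^esub> (braid_gen n 1) \<otimes>\<^bsub>braid_group n\<^esub> y) ys"
    by (rule nth_equalityI) (auto simp del: upt_Suc)
  moreover have "\<forall>i\<le>length ys. ?b i \<in> braid_sub n {2..n - 1}"
    using P by (auto simp: nth_Cons split: nat.split)
  ultimately show "r1_negative n \<beta>"
    unfolding r1_negative_def braid_sub_def[symmetric] using P
    by (intro exI[of _ "length ys"] exI[of _ ?b]) (auto simp: Suc_le_eq simp del: upt_Suc)
qed

context
  fixes n :: nat
  assumes n: "n \<ge> 2"
begin

abbreviation (input) "BG \<equiv> braid_group n"
abbreviation (input) "BU \<equiv> braid_sub n {2..n - 1}"

lemma U_subgroup: "subgroup BU BG" by (rule braid_sub_subgroup) auto
lemma U_closed: "u \<in> BU \<Longrightarrow> u \<in> carrier BG" using subgroup.mem_carrier[OF U_subgroup] .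
lemma gen1: "braid_gen n 1 \<in> carrier BG" using n by (intro braid_gen_closed) auto

lemma r1_list_closed:
  "set ys \<subseteq> BU \<Longrightarrow> list_prod BG (map (\<lambda>y. inv\<^bsub>BG\<^esub> (braid_gen n 1) \<otimes>\<^bsub>BG\<^esub> y) ys) \<in> carrier BG"
  by (induction ys) (use gen1 U_closed in auto)

lemma r1_negative_base:
  assumes "u \<in> BU" "v \<in> BU"
  shows "r1_negative n (u \<otimes>\<^bsub>BG\<^esub> inv\<^bsub>BG\<^esub> (braid_gen n 1) \<otimes>\<^bsub>BG\<^esub> v)"
  unfolding r1_negative_iff using assms gen1 U_closed
  by (intro exI[of _ u] exI[of _ "[v]"]) (simp add: braid.m_assoc)

text \<open>The last factor \<open>z\<close> of the first product and the leading factor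
  \<open>u'\<close> of the second both lie in \<open>BU\<close> and merge into one.\<close>

lemma r1_negative_mult:
  assumes "r1_negative n a" "r1_negative n b"
  shows "r1_negative n (a \<otimes>\<^bsub>BG\<^esub> b)"
proof -
  let ?f = "\<lambda>y. inv\<^bsub>BG\<^esub> (braid_gen n 1) \<otimes>\<^bsub>BG\<^esub> y"
  obtain u ys where a: "u \<in> BU" "ys \<noteq> []" "set ys \<subseteq> BU" "a = u \<otimes>\<^bsub>BG\<^esub> list_prod BG (map ?f ys)"
    using assms(1) unfolding r1_negative_iff by blast
  obtain zs z where ys: "ys = zs @ [z]" using a(2) by (metis append_butlast_last_id)
  obtain u' ys' where b: "u' \<in> BU" "ys' \<noteq> []" "set ys' \<subseteq> BU" "b = u' \<otimes>\<^bsub>BG\<^esub> list_prod BG (map ?f ys')"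
    using assms(2) unfolding r1_negative_iff by blast
  have c: "set (map ?f xs) \<subseteq> carrier BG" if "set xs \<subseteq> BU" for xs
    using that gen1 U_closed by auto
  have z: "z \<in> BU" "set zs \<subseteq> BU" using a ys by auto
  have "a \<otimes>\<^bsub>BG\<^esub> b = u \<otimes>\<^bsub>BG\<^esub> list_prod BG (map ?f (zs @ (z \<otimes>\<^bsub>BG\<^esub> u') # ys'))"
    using z a(1) b(1,3) gen1 U_closed c[OF z(2)] c[OF b(3)]
    by (simp add: a(4) b(4) ys braid.list_prod_append braid.m_assoc)
  moreover have "z \<otimes>\<^bsub>BG\<^esub> u' \<in> BU" using z b subgroup.m_closed[OF U_subgroup] by blast
  ultimately show ?thesis unfolding r1_negative_iff using a(1) z b(3)
    by (intro exI[of _ u] exI[of _ "zs @ (z \<otimes>\<^bsub>BG\<^esub> u') # ys'"]) simp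
qed

lemma act_gen:
  assumes "x \<in> dyn_states" "i \<in> {1..n - 1}"
  shows "braid.act (braid_gen n i) x = dyn_step (i, True) x"
  using braid.act_word_class[of "positive_word [i]" n x] assms
  by (simp add: braid_gen_def positive_word_def)

text \<open>A generator r_i with i >= 2 rewrites only positions i and i + 1, hence never position
  1.\<close>

lemma act_U:
  assumes "u \<in> BU" "x \<in> dyn_states"
  shows "fst (braid.act u x 1) = fst (x 1)"
  using assms(1)[unfolded braid_sub_def] assms(2)
proof (induction arbitrary: x rule: generate.induct)
  case one
  then show ?case by (simp add: braid_act_one)
next
  case (incl h)
  then show ?case by (auto simp: act_gen dyn_step_other)
next
  case (inv h)
  then obtain i where i: "h = braid_gen n i" "i \<in> {2..n - 1}" by blast
  then have h: "h \<in> carrier BG" by (auto intro!: braid_gen_closed)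
  \<comment> \<open>Since \<open>h\<close> sends \<open>?y\<close> back to \<open>x\<close> without
    touching position 1, both states agree there.\<close>
  let ?y = "braid.act (inv\<^bsub>BG\<^esub> h) x"
  have "?y \<in> dyn_states" "x = braid.act h ?y"
    using h inv by (simp_all add: braid_act_closed[of _ n] braid_act_inv)
  moreover have "braid.act h ?y = dyn_step (i, True) ?y" "dyn_step (i, True) ?y 1 = ?y 1"
    using i \<open>?y \<in> dyn_states\<close> by (simp_all add: act_gen dyn_step_other)
  ultimately show ?case by metis
next
  case (eng h1 h2)
  then have "h1 \<in> carrier BG" "h2 \<in> carrier BG" using U_closed unfolding braid_sub_def by blast+
  then show ?case using eng by (simp add: braid_act_mult braid_act_closed[of _ n])
qed

lemma act_inv_gen1:
  assumes "x \<in> dyn_states"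
  shows "fst (braid.act (inv\<^bsub>BG\<^esub> (braid_gen n 1)) x 1) < fst (x 1)"
proof -
  let ?y = "braid.act (inv\<^bsub>BG\<^esub> (braid_gen n 1)) x"
  have "?y \<in> dyn_states" "x = braid.act (braid_gen n 1) ?y"
    using gen1 assms by (simp_all add: braid_act_closed[of _ n] braid_act_inv)
  then show ?thesis using fst_dyn_step_1[of ?y] act_gen[of ?y 1] n by simp
qed

lemma r1_negative_act:
  assumes "r1_negative n a" "x \<in> dyn_states"
  shows "fst (braid.act a x 1) < fst (x 1)"
proof -
  let ?f = "\<lambda>y. inv\<^bsub>BG\<^esub> (braid_gen n 1) \<otimes>\<^bsub>BG\<^esub> y"
  obtain u ys where a: "u \<in> BU" "ys \<noteq> []" "set ys \<subseteq> BU" "a = u \<otimes>\<^bsub>BG\<^esub> list_prod BG (map ?f ys)"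
    using assms(1) unfolding r1_negative_iff by blast
  \<comment> \<open>The weak inequality covers the empty list, where the induction starts;
    strictness is claimed only once some r_1^{-1} occurs.\<close>
  have *: "fst (braid.act (list_prod BG (map ?f ys)) x 1) \<le> fst (x 1) \<and>
     (ys \<noteq> [] \<longrightarrow> fst (braid.act (list_prod BG (map ?f ys)) x 1) < fst (x 1))"
    if "set ys \<subseteq> BU" "x \<in> dyn_states" for ys x
    using that
  proof (induction ys arbitrary: x)
    case Nil
    then show ?case by (simp add: braid_act_one)
  next
    case (Cons y ys)
    then have y: "y \<in> carrier BG" "?f y \<in> carrier BG" "list_prod BG (map ?f ys) \<in> carrier BG"
      using U_closed gen1 r1_list_closed by auto
    let ?x' = "braid.act (inv\<^bsub>BG\<^esub> (braid_gen n 1)) x"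
    let ?x = "braid.act (?f y) x"
    have x': "?x' \<in> dyn_states" "?x \<in> dyn_states" "?x = braid.act y ?x'"
      using gen1 Cons.prems y by (simp_all add: braid_act_closed[of _ n] braid_act_mult)
    have "fst (?x 1) < fst (x 1)" using act_inv_gen1[OF Cons.prems(2)] act_U[of y ?x'] x' Cons.prems by simp
    moreover have "braid.act (list_prod BG (map ?f (y # ys))) x = braid.act (list_prod BG (map ?f ys)) ?x"
      using y Cons.prems by (simp add: braid_act_mult del: braid.m_assoc)
    moreover have "fst (braid.act (list_prod BG (map ?f ys)) ?x 1) \<le> fst (?x 1)" using Cons x' by auto
    ultimately show ?case by simp
  qed
  have "list_prod BG (map ?f ys) \<in> carrier BG"
    using r1_list_closed a by blast
  then have "braid.act a x = braid.act (list_prod BG (map ?f ys)) (braid.act u x)" "braid.act u x \<in> dyn_states"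
    using a U_closed assms by (simp_all add: braid_act_mult braid_act_closed[of _ n])
  then show ?thesis using *[of ys "braid.act u x"] act_U[OF a(1) assms(2)] a by simp
qed

lemma positive_act:
  assumes "set is \<subseteq> {1..n - 1}" "x \<in> dyn_states"
  shows "fst (x 1) \<le> fst (braid.act (list_prod BG (map (braid_gen n) is)) x 1)"
  using assms
proof (induction "is" arbitrary: x)
  case Nil
  then show ?case by (simp add: braid_act_one)
next
  case (Cons i "is")
  then have c: "braid_gen n i \<in> carrier BG" "list_prod BG (map (braid_gen n) is) \<in> carrier BG"
    by (auto intro!: braid_gen_list_closed braid_gen_closed)
  let ?x = "dyn_step (i, True) x"
  have x: "?x = braid.act (braid_gen n i) x" using Cons.prems by (simp add: act_gen)
  then have "?x \<in> dyn_states" using c Cons.prems by (simp add: braid_act_closed[of _ n])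
  moreover have "fst (x 1) \<le> fst (?x 1)"
    using Cons.prems fst_dyn_step_1[of x] dyn_step_other[of 1 i True x] by (cases "i = 1") auto
  moreover have "braid.act (list_prod BG (map (braid_gen n) (i # is))) x =
      braid.act (list_prod BG (map (braid_gen n) is)) ?x"
    using c x Cons.prems by (simp add: braid_act_mult)
  ultimately show ?case using Cons by force
qed

text \<open>One test state suffices: its first coordinate drops under an r_1-negative braid, is
  constant under \<open>BU\<close> and does not drop under a positive braid. For the last claim,
  \<open>a\<close> times its inverse would make the identity r_1-negative, although the identity
  lies in \<open>BU\<close>.\<close>

lemma not_r1_negative:
  shows "u \<in> BU \<Longrightarrow> \<not> r1_negative n u"
    and "set is \<subseteq> {1..n - 1} \<Longrightarrow> \<not> r1_negative n (list_prod BG (map (braid_gen n) is))"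
    and "r1_negative n (inv\<^bsub>BG\<^esub> a) \<Longrightarrow> a \<in> carrier BG \<Longrightarrow> \<not> r1_negative n a"
proof -
  have x: "(\<lambda>_. (1, 1)) \<in> dyn_states" by (simp add: dyn_states_def)
  show 1: "\<not> r1_negative n u" if "u \<in> BU" for u
    using act_U[OF that x] r1_negative_act[of u, OF _ x] by auto
  show "\<not> r1_negative n (list_prod BG (map (braid_gen n) is))" if "set is \<subseteq> {1..n - 1}"
    using positive_act[OF that x] r1_negative_act[OF _ x] by (meson not_less)
  show "\<not> r1_negative n a" if "r1_negative n (inv\<^bsub>BG\<^esub> a)" "a \<in> carrier BG"
    using r1_negative_mult[OF _ that(1), of a] 1[OF subgroup.one_closed[OF U_subgroup]] that(2) by auto
qed

end

section \<open>Normal forms in the dihedral Artin group\<close>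

fun other :: "I2_gen \<Rightarrow> I2_gen" where
  "other Gen_s = Gen_t"
| "other Gen_t = Gen_s"

lemma other_other [simp]: "other (other x) = x" by (cases x) auto
lemma other_neq [simp]: "other x \<noteq> x" "x \<noteq> other x" by (cases x; simp)+
lemma neq_iff_other: "x \<noteq> y \<longleftrightarrow> x = other y" by (cases x; cases y) auto

abbreviation (input) alt :: "I2_gen \<Rightarrow> nat \<Rightarrow> I2_gen list" where
  "alt x n \<equiv> alternating x (other x) n"

lemma length_alternating [simp]: "length (alternating x y n) = n"
  by (induction n arbitrary: x y) auto

lemma alternating_add:
  "alternating x y (i + j) = alternating x y i @ (if even i then alternating x y j else alternating y x j)"
  by (induction i arbitrary: x y) auto

lemma alternating_snoc: "alternating x y (Suc n) = alternating x y n @ [if even n then x else y]"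
  using alternating_add[of x y n 1] by simp

lemma rev_alternating: "rev (alternating x y n) = (if even n then alternating y x n else alternating x y n)"
proof (induction n arbitrary: x y)
  case (Suc n)
  then show ?case using alternating_snoc[of x y n] alternating_snoc[of y x n] by auto
qed simp

lemma take_alternating: "i \<le> n \<Longrightarrow> take i (alternating x y n) = alternating x y i"
  using alternating_add[of x y i "n - i"] by simp

text \<open>The excluded factors are the two alternating words for \<Delta>; reduced words will
  represent the unmovable elements.\<close>

definition reduced :: "nat \<Rightarrow> I2_gen list \<Rightarrow> bool" where
  "reduced m w \<longleftrightarrow> (\<forall>p q x. w \<noteq> p @ alt x m @ q)"

lemma reduced_appendD: "reduced m (u @ v) \<Longrightarrow> reduced m u" "reduced m (u @ v) \<Longrightarrow> reduced m v"
  unfolding reduced_def by (metis append.assoc)+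

lemma reduced_ConsD: "reduced m (x # w) \<Longrightarrow> reduced m w"
  using reduced_appendD(2)[of m "[x]"] by simp

lemma reduced_Nil [simp]: "m \<ge> 1 \<Longrightarrow> reduced m []"
  unfolding reduced_def by (cases m) auto

lemma reduced_rev [simp]: "reduced m (rev w) \<longleftrightarrow> reduced m w"
proof -
  have "reduced m (rev w)" if "reduced m w" for w
    unfolding reduced_def
  proof (intro allI notI)
    fix p q x assume "rev w = p @ alt x m @ q"
    then have "w = rev q @ rev (alt x m) @ rev p" by (metis append.assoc rev_append rev_rev_ident)
    moreover obtain y where "rev (alt x m) = alt y m"
      using rev_alternating[of x "other x" m] other_other by metis
    ultimately show False using that unfolding reduced_def by metis
  qed
  from this[of w] this[of "rev w"] show ?thesis by auto
qed

lemma reduced_Cons_iff: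
  assumes "m \<ge> 1"
  shows "reduced m (x # w) \<longleftrightarrow> reduced m w \<and> take m (x # w) \<noteq> alt x m"
proof (intro iffI conjI notI)
  assume r: "reduced m (x # w)"
  then show "reduced m w" by (rule reduced_ConsD)
  assume "take m (x # w) = alt x m"
  then have "x # w = [] @ alt x m @ drop m (x # w)" by (metis append_Nil append_take_drop_id)
  with r show False unfolding reduced_def by blast
next
  assume r: "reduced m w \<and> take m (x # w) \<noteq> alt x m"
  show "reduced m (x # w)" unfolding reduced_def
  proof (intro allI notI)
    fix p q y assume eq: "x # w = p @ alt y m @ q"
    show False
    proof (cases p)
      case Nil
      moreover have "take m (alt y m @ q) = alt y m" by simp
      moreover have "x = y" using eq Nil assms by (cases m) auto
      ultimately show False using eq r by simp
    next
      case (Cons z p')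
      then have "w = p' @ alt y m @ q" using eq by simp
      then show False using r unfolding reduced_def by blast
    qed
  qed
qed

text \<open>The head condition makes \<open>w\<close> repeat the last letter of the alternating
  prefix, so no alternating factor crosses the junction; the prefix is too short to contain one of
  length \<open>m\<close>, and \<open>w\<close> is reduced.\<close>

lemma reduced_alternating_append:
  assumes "n < m" "reduced m w" "w = [] \<or> hd w = (if odd n then x else other x)"
  shows "reduced m (alt x n @ w)"
  using assms
proof (induction n arbitrary: x)
  case (Suc n)
  have IH: "reduced m (alt (other x) n @ w)" using Suc by (intro Suc.IH) auto
  have "take m (x # alt (other x) n @ w) \<noteq> alt x m"
  proof
    assume eq: "take m (x # alt (other x) n @ w) = alt x m"
    have "length (take m (x # alt (other x) n @ w)) = m" by (simp only: eq length_alternating)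
    then have "m \<le> length (x # alt (other x) n @ w)" by simp
    then obtain y w' where w: "w = y # w'" using Suc.prems(1) by (cases w) auto
    then have "take (Suc (Suc n)) (alt x m) = alt x (Suc n) @ [y]"
      using Suc.prems(1) unfolding eq[symmetric] by simp
    moreover have "take (Suc (Suc n)) (alt x m) = alt x (Suc n) @ [if even (Suc n) then x else other x]"
      using Suc.prems(1) by (simp only: take_alternating Suc_leI alternating_snoc[of _ _ "Suc n"])
    ultimately show False using Suc.prems(3) w by (auto split: if_splits)
  qed
  with IH Suc.prems(1) show ?case by (simp add: reduced_Cons_iff)
qed simp

text \<open>A maximal run of s is counted at its last letter, so prepending a letter changes the
  count only when it opens a new block.\<close>

fun s_blocks :: "I2_gen list \<Rightarrow> nat" where
  "s_blocks [] = 0"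
| "s_blocks (x # w) = s_blocks w + (if x = Gen_s \<and> (w = [] \<or> hd w \<noteq> Gen_s) then 1 else 0)"

lemma s_blocks_snoc:
  "s_blocks (w @ [x]) = s_blocks w + (if x = Gen_s \<and> (w = [] \<or> last w \<noteq> Gen_s) then 1 else 0)"
  by (induction w) (auto simp: hd_append)

lemma s_blocks_rev [simp]: "s_blocks (rev w) = s_blocks w"
  by (induction w) (auto simp: s_blocks_snoc last_rev)

lemma s_blocks_append_t: "s_blocks (w @ replicate e Gen_t) = s_blocks w"
  by (induction e) (simp_all add: s_blocks_snoc replicate_append_same[symmetric] flip: append_assoc)

lemma s_blocks_append_s:
  "e \<ge> 1 \<Longrightarrow> w = [] \<or> last w \<noteq> Gen_s \<Longrightarrow> s_blocks (w @ replicate e Gen_s) = Suc (s_blocks w)"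
proof (induction e rule: nat_induct_at_least)
  case base
  then show ?case by (simp add: s_blocks_snoc)
next
  case (Suc e)
  have "w @ replicate (Suc e) Gen_s = (w @ replicate e Gen_s) @ [Gen_s]" by (simp add: replicate_append_same)
  with Suc show ?case by (simp only: s_blocks_snoc) (auto simp: last_append)
qed

text \<open>An alternating word ending in s may share its last block with the start of
  \<open>w\<close>; the second equation therefore keeps that \<open>Gen_s\<close> in front of
  \<open>w\<close>.\<close>

lemma s_blocks_alternating:
  "s_blocks (alternating Gen_s Gen_t (2 * i) @ w) = i + s_blocks w"
  "s_blocks (alternating Gen_s Gen_t (Suc (2 * i)) @ w) = i + s_blocks (Gen_s # w)"
  "s_blocks (alternating Gen_t Gen_s (Suc (2 * i)) @ w) = i + s_blocks w"
proof -
  show *: "s_blocks (alternating Gen_s Gen_t (2 * i) @ w) = i + s_blocks w" for w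
    by (induction i) auto
  show "s_blocks (alternating Gen_s Gen_t (Suc (2 * i)) @ w) = i + s_blocks (Gen_s # w)"
    using *[of "Gen_s # w"] alternating_snoc[of Gen_s Gen_t "2 * i"] by simp
  show "s_blocks (alternating Gen_t Gen_s (Suc (2 * i)) @ w) = i + s_blocks w"
    using * by simp
qed

text \<open>Cutting inside an s-block would count it twice, so the construction never cuts
  there.\<close>

lemma s_blocks_split:
  assumes "s_blocks c \<le> p + q"
  obtains c1 c2 where "c = c1 @ c2" "s_blocks c1 \<le> p" "s_blocks c2 \<le> q"
proof -
  have "\<exists>c1 c2. c = c1 @ c2 \<and> s_blocks c1 \<le> p \<and> s_blocks c2 \<le> q"
    using assms
  proof (induction c arbitrary: p)
    case (Cons x c)
    show ?case
    proof (cases "x = Gen_s \<and> (c = [] \<or> hd c \<noteq> Gen_s)")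
      case True
      show ?thesis
      proof (cases p)
        case 0
        then show ?thesis using Cons.prems by (intro exI[of _ "[]"] exI[of _ "x # c"]) simp
      next
        case (Suc p')
        with Cons.prems True have "s_blocks c \<le> p' + q" by simp
        from Cons.IH[OF this] obtain c1 c2 where "c = c1 @ c2" "s_blocks c1 \<le> p'" "s_blocks c2 \<le> q" by blast
        with Suc show ?thesis by (intro exI[of _ "x # c1"] exI[of _ c2]) simp
      qed
    next
      case False
      then have eq: "s_blocks (x # c) = s_blocks c" by simp
      with Cons.prems have "s_blocks c \<le> p + q" by simp
      from Cons.IH[OF this] obtain c1 c2 where c: "c = c1 @ c2" "s_blocks c1 \<le> p" "s_blocks c2 \<le> q" by blast
      show ?thesis
      proof (cases c1)
        case Nil
        \<comment> \<open>In front of an empty first piece an s would open a block there, so the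
          letter joins the second piece instead.\<close>
        then show ?thesis using c eq by (intro exI[of _ "[]"] exI[of _ "x # c"]) simp
      next
        case (Cons y c1')
        then show ?thesis using c False by (intro exI[of _ "x # c1"] exI[of _ c2]) auto
      qed
    qed
  qed simp
  then show ?thesis using that by blast
qed

text \<open>The state \<open>(w, j)\<close> stands for the word \<open>rev w\<close> times
  \<Delta>^j, so right multiplication acts at the head of \<open>w\<close>. A positive letter
  completing an alternating run of length \<open>m\<close> turns the run into one more \<Delta>. A
  negative letter cancels, or is replaced by an alternating word of length \<open>m - 1\<close>
  times \<Delta>^{-1}; for even \<open>m\<close> that word is a palindrome, so reversal does not
  affect it.\<close>

fun i2_step :: "nat \<Rightarrow> I2_gen \<times> bool \<Rightarrow> I2_gen list \<times> int \<Rightarrow> I2_gen list \<times> int" where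
  "i2_step m (x, True) (w, j) =
     (if take (m - 1) w = alt (other x) (m - 1) then (drop (m - 1) w, j + 1) else (x # w, j))"
| "i2_step m (x, False) (w, j) =
     (if w \<noteq> [] \<and> hd w = x then (tl w, j) else (alt (other x) (m - 1) @ w, j - 1))"

definition i2_states :: "nat \<Rightarrow> (I2_gen list \<times> int) set" where
  "i2_states m = {w. reduced m w} \<times> UNIV"

section \<open>The Artin group acting on reduced words with an exponent\<close>

locale dihedral_artin =
  fixes k :: nat
  assumes k: "k \<ge> 2"
begin

abbreviation "m \<equiv> 2 * k"

lemma alt_m: "alt x m = x # alt (other x) (m - 1)" "alt x m = alt x (m - 1) @ [other x]"
proof -
  have m: "alt x m = alt x (Suc (m - 1))" "odd (m - 1)" using k by auto
  show "alt x m = x # alt (other x) (m - 1)" unfolding m(1) by simp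
  show "alt x m = alt x (m - 1) @ [other x]" unfolding m(1) alternating_snoc using m(2) by simp
qed

lemma reduced_m_Cons:
  "reduced m (x # w) \<longleftrightarrow> reduced m w \<and> take (m - 1) w \<noteq> alt (other x) (m - 1)"
proof -
  have "take m (x # w) = x # take (m - 1) w" using k by (simp add: take_Cons')
  moreover have "m \<ge> 1" using k by simp
  ultimately show ?thesis by (simp only: reduced_Cons_iff alt_m(1) list.inject simp_thms)
qed

lemma i2_push:
  assumes "reduced m (x # w)"
  shows "i2_step m (x, True) (w, j) = (x # w, j)"
proof -
  have "take (m - 1) w \<noteq> alt (other x) (m - 1)" using assms reduced_m_Cons by blast
  then show ?thesis by (simp only: i2_step.simps if_False)
qed

lemma fold_push:
  "reduced m (rev u @ w) \<Longrightarrow> fold (i2_step m) (positive_word u) (w, j) = (rev u @ w, j)"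
proof (induction u arbitrary: w)
  case (Cons x u)
  then have "reduced m (x # w)" using reduced_appendD(2)[of m "rev u" "x # w"] by simp
  then show ?case using Cons i2_push[of x w j] by (simp add: positive_word_def)
qed (simp add: positive_word_def)

text \<open>Either alternating word only raises the exponent, so the action respects the defining
  relation. If its first letter equals the head of \<open>w\<close>, then \<open>m - 1\<close>
  letters are stored and the last one completes \<Delta>; otherwise the head of \<open>w\<close> is
  moved past \<Delta>.\<close>

lemma fold_alternating:
  "reduced m w \<Longrightarrow> fold (i2_step m) (positive_word (alt x m)) (w, j) = (w, j + 1)"
proof (induction w arbitrary: x)
  case base: Nil
  have "reduced m (rev (alt x (m - 1)) @ [])"
    using reduced_alternating_append[of "m - 1" m "[]" x] k by (simp add: rev_alternating)
  from fold_push[OF this] show ?case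
    using k by (simp add: alt_m(2) positive_word_append rev_alternating) (simp add: positive_word_def)
next
  case (Cons y w)
  show ?case
  proof (cases "x = y")
    case True
    have "reduced m (rev (alt x (m - 1)) @ y # w)"
      using reduced_alternating_append[of "m - 1" m "y # w" x] k Cons.prems True by (simp add: rev_alternating)
    from fold_push[OF this] show ?thesis
      using k by (simp add: alt_m(2) positive_word_append rev_alternating) (simp add: positive_word_def)
  next
    case False
    then have x: "x = other y" by (simp add: neq_iff_other)
    have w: "reduced m w" using Cons.prems by (rule reduced_ConsD)
    \<comment> \<open>The alternating word of length \<open>m + 1\<close> has \<Delta> both as a
      prefix and as a suffix. Pushing \<open>y\<close> before or after \<Delta> thus gives the same
      state, and induction handles the tail.\<close>
    have "y # alt x m = alt y m @ [y]"
      using alternating_snoc[of y "other y" m] x by simp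
    then have "positive_word (y # alt x m) = positive_word (alt y m) @ [(y, True)]"
      by (simp add: positive_word_append) (simp add: positive_word_def)
    then have "fold (i2_step m) (positive_word (y # alt x m)) (w, j) = i2_step m (y, True) (w, j + 1)"
      using Cons.IH[OF w, of y] by simp
    then show ?thesis using i2_push[OF Cons.prems] by (simp add: positive_word_def)
  qed
qed

sublocale i2: word_action UNIV "artin_I2_rels m" "i2_step m" "i2_states m"
proof
  fix x e and st :: "I2_gen list \<times> int"
  assume "st \<in> i2_states m"
  then obtain w j where st: "st = (w, j)" and w: "reduced m w" by (auto simp: i2_states_def)
  have td: "w = take (m - 1) w @ drop (m - 1) w" by simp
  \<comment> \<open>Otherwise the removed run followed by \<open>x\<close> would be a forbidden
    factor of \<open>w\<close>. Hence the inverse step restores the run rather than cancelling a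
    letter.\<close>
  have drop: "drop (m - 1) w = [] \<or> hd (drop (m - 1) w) \<noteq> x" if "take (m - 1) w = alt (other x) (m - 1)"
  proof (rule ccontr)
    assume "\<not> ?thesis"
    then obtain q where "drop (m - 1) w = x # q" by (metis list.collapse)
    then have "w = [] @ alt (other x) m @ q" using that td alt_m(2)[of "other x"] by simp
    then show False using w unfolding reduced_def by blast
  qed
  have pop: "reduced m (alt (other x) (m - 1) @ w)" if "w = [] \<or> hd w \<noteq> x"
    using that k w by (intro reduced_alternating_append) (auto simp: neq_iff_other)
  show "i2_step m (x, e) st \<in> i2_states m"
  proof (cases e)
    case True
    have "reduced m (drop (m - 1) w)" using w td reduced_appendD(2) by metis
    moreover have "reduced m (x # w)" if "take (m - 1) w \<noteq> alt (other x) (m - 1)"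
      using that w reduced_m_Cons by blast
    ultimately show ?thesis using True st by (simp add: i2_states_def)
  next
    case False
    then show ?thesis using st w pop by (cases w) (auto simp: i2_states_def dest: reduced_ConsD)
  qed
  show "i2_step m (x, \<not> e) (i2_step m (x, e) st) = st"
  proof (cases e)
    case True
    have "alt (other x) (m - 1) @ drop (m - 1) w = w" if "take (m - 1) w = alt (other x) (m - 1)"
      using that by (metis append_take_drop_id)
    with True show ?thesis using st drop by auto
  next
    case False
    show ?thesis
    proof (cases "w \<noteq> [] \<and> hd w = x")
      case True
      then have "reduced m (x # tl w)" using w by auto
      then show ?thesis using st \<open>\<not> e\<close> True i2_push by auto
    next
      case f: False
      then show ?thesis using st \<open>\<not> e\<close> by auto
    qed
  qed
next
  fix a b and st :: "I2_gen list \<times> int"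
  assume "(a, b) \<in> artin_I2_rels m" "st \<in> i2_states m"
  then show "fold (i2_step m) a st = fold (i2_step m) b st"
    using fold_alternating[of _ Gen_s] fold_alternating[of _ Gen_t]
    by (auto simp: artin_I2_rels_def i2_states_def)
qed

section \<open>Positive elements, the central element \<Delta> and the submonoids\<close>

abbreviation "G \<equiv> artin_I2 m"
abbreviation mul (infixl "\<cdot>" 70) where "x \<cdot> y \<equiv> x \<otimes>\<^bsub>G\<^esub> y"
abbreviation Delta ("\<Delta>") where "\<Delta> \<equiv> artin_Delta m"

sublocale G: group G
  unfolding artin_I2_def by (rule group_presented_group)

lemmas act_mult = i2.act_mult[folded artin_I2_def]
  and act_closed = i2.act_closed[folded artin_I2_def]
  and act_one = i2.act_one[folded artin_I2_def]
  and act_inv = i2.act_inv[folded artin_I2_def]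

definition pos :: "I2_gen list \<Rightarrow> I2_gen word set" where
  "pos w = word_class UNIV (artin_I2_rels m) (positive_word w)"

lemma pos_word: "positive_word w \<in> words UNIV" by (rule positive_word_words) simp

lemma pos_closed [simp]: "pos w \<in> carrier G"
  unfolding pos_def artin_I2_def carrier_presented_group using pos_word by (rule imageI)

lemma pos_append: "pos (u @ v) = pos u \<cdot> pos v"
  unfolding pos_def artin_I2_def mult_presented_group[OF pos_word pos_word] positive_word_append ..

lemma pos_Nil [simp]: "pos [] = \<one>\<^bsub>G\<^esub>"
  by (simp add: pos_def artin_I2_def one_presented_group positive_word_def)

lemma pos_Cons: "pos (x # w) = pos [x] \<cdot> pos w"
  using pos_append[of "[x]" w] by simp

lemma pos_gens: "artin_s m = pos [Gen_s]" "artin_t m = pos [Gen_t]"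
  by (simp_all add: artin_s_def artin_t_def pos_def)

lemma list_prod_pos: "list_prod G (map (\<lambda>x. pos [x]) w) = pos w"
proof (induction w)
  case (Cons x w)
  then show ?case using pos_Cons[of x w] by simp
qed simp

lemma Delta_eq: "\<Delta> = pos (alt x m)"
proof -
  have "map (\<lambda>x. pos [x]) (alternating y z n) = alternating (pos [y]) (pos [z]) n" for y z n
    by (induction n arbitrary: y z) auto
  then have s: "\<Delta> = pos (alt Gen_s m)"
    unfolding artin_Delta_def pos_gens using list_prod_pos[of "alt Gen_s m"] by simp
  have "(positive_word (alt Gen_s m), positive_word (alt Gen_t m)) \<in> artin_I2_rels m"
    by (simp add: artin_I2_rels_def)
  from word_cong.rel[OF _ _ pos_word pos_word this, of "[]" "[]"]
  have "(positive_word (alt Gen_s m), positive_word (alt Gen_t m)) \<in> word_cong UNIV (artin_I2_rels m)"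
    by simp
  then have "pos (alt Gen_s m) = pos (alt Gen_t m)"
    unfolding pos_def using word_class_eq_iff[OF pos_word pos_word] by blast
  with s show ?thesis by (cases x) auto
qed

lemma Delta_closed [simp]: "\<Delta> \<in> carrier G" by (simp add: Delta_eq[of Gen_s])

definition letter :: "I2_gen \<times> bool \<Rightarrow> I2_gen word set" where
  "letter l = (if snd l then pos [fst l] else inv\<^bsub>G\<^esub> pos [fst l])"

lemma letter_closed [simp]: "letter l \<in> carrier G" by (simp add: letter_def)

lemma letter_eq: "letter l = word_class UNIV (artin_I2_rels m) [l]"
proof -
  obtain x e where l: "l = (x, e)" by force
  show ?thesis
  proof (cases e)
    case True
    then show ?thesis by (simp add: l letter_def pos_def positive_word_def)
  next
    case False
    let ?y = "word_class UNIV (artin_I2_rels m) [(x, False)]"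
    have w: "[(x, False)] \<in> words UNIV" "[(x, True)] \<in> words UNIV" "[(x, False), (x, True)] \<in> words UNIV" "[] \<in> words UNIV"
      by auto
    have "?y \<cdot> pos [x] = word_class UNIV (artin_I2_rels m) [(x, False), (x, True)]"
      using mult_presented_group[OF w(1,2)] by (simp add: pos_def positive_word_def artin_I2_def)
    also have "\<dots> = \<one>\<^bsub>G\<^esub>"
      unfolding artin_I2_def one_presented_group word_class_eq_iff[OF w(3,4)]
      using word_cong.cancel[of "[]" UNIV "[]" x False] by simp
    finally have "?y \<cdot> pos [x] = \<one>\<^bsub>G\<^esub>" .
    moreover have "?y \<in> carrier G"
      unfolding artin_I2_def carrier_presented_group using w by blast
    ultimately show ?thesis using False G.inv_equality by (simp add: l letter_def)
  qed
qed

text \<open>Elements are built up by right multiplication, matching the direction of the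
  action.\<close>

lemma carrier_induct [consumes 1, case_names one mult]:
  assumes "g \<in> carrier G" "P \<one>\<^bsub>G\<^esub>" "\<And>l h. h \<in> carrier G \<Longrightarrow> P h \<Longrightarrow> P (h \<cdot> letter l)"
  shows "P g"
proof -
  obtain w where "g = word_class UNIV (artin_I2_rels m) w"
    using assms(1) unfolding artin_I2_def carrier_presented_group by blast
  moreover have "word_class UNIV (artin_I2_rels m) w \<in> carrier G \<and> P (word_class UNIV (artin_I2_rels m) w)"
  proof (induction w rule: rev_induct)
    case Nil
    then show ?case using assms(2) G.one_closed by (simp add: artin_I2_def one_presented_group)
  next
    case (snoc l w)
    have w: "w \<in> words UNIV" "[l] \<in> words UNIV" by auto
    have "word_class UNIV (artin_I2_rels m) (w @ [l]) = word_class UNIV (artin_I2_rels m) w \<cdot> letter l"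
      unfolding letter_eq artin_I2_def mult_presented_group[OF w] ..
    then show ?case using snoc assms(3) by simp
  qed
  ultimately show ?thesis by simp
qed

lemma Delta_central: "g \<in> carrier G \<Longrightarrow> g \<cdot> \<Delta> = \<Delta> \<cdot> g"
proof (induction rule: carrier_induct)
  case (mult l h)
  have gen: "pos [x] \<cdot> \<Delta> = \<Delta> \<cdot> pos [x]" for x
  proof -
    \<comment> \<open>As \<open>m\<close> is even, the alternating word of length
      \<open>m + 1\<close> is both \<open>x\<close> followed by \<Delta> and \<Delta> followed by
      \<open>x\<close>.\<close>
    have "pos [x] \<cdot> pos (alt (other x) m) = pos (alt x m @ [x])"
      using alternating_snoc[of x "other x" m] by (simp flip: pos_append)
    then show ?thesis unfolding Delta_eq[of x, symmetric] Delta_eq[of "other x", symmetric] pos_append .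
  qed
  have "letter l \<cdot> \<Delta> = \<Delta> \<cdot> letter l"
    unfolding letter_def using gen[of "fst l"] G.commute_inv[of \<Delta> "pos [fst l]"] by simp
  with mult show ?case by (simp add: G.m_assoc) (simp flip: G.m_assoc)
qed simp

lemma Delta_pow_central: "g \<in> carrier G \<Longrightarrow> g \<cdot> (\<Delta> [^]\<^bsub>G\<^esub> (j::int)) = (\<Delta> [^]\<^bsub>G\<^esub> j) \<cdot> g"
proof -
  assume g: "g \<in> carrier G"
  have n: "g \<cdot> (\<Delta> [^]\<^bsub>G\<^esub> (n::nat)) = (\<Delta> [^]\<^bsub>G\<^esub> n) \<cdot> g" for n
  proof (induction n)
    case (Suc n)
    then show ?case using g Delta_central[OF g] by (simp flip: G.m_assoc) (simp add: G.m_assoc)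
  qed (use g in simp)
  show ?thesis
  proof (cases j)
    case (nonneg n)
    then show ?thesis using n by (simp only: int_pow_int)
  next
    case (neg i)
    then have "\<Delta> [^]\<^bsub>G\<^esub> j = inv\<^bsub>G\<^esub> (\<Delta> [^]\<^bsub>G\<^esub> Suc i)"
      using G.int_pow_neg[OF Delta_closed, of "int (Suc i)"] by (simp only: int_pow_int)
    then show ?thesis using G.commute_inv[OF g G.nat_pow_closed[OF Delta_closed] n, of "Suc i"] by (simp only:)
  qed
qed

lemma M_eq: "artin_M m = range pos"
proof (intro equalityI subsetI)
  fix x assume "x \<in> artin_M m"
  then show "x \<in> range pos" unfolding artin_M_def
  proof (induction rule: generate_monoid.induct)
    case one
    show ?case using rangeI[of pos "[]"] by simp
  next
    case (mult x y)
    then show ?case by (auto simp flip: pos_append)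
  qed (auto simp: pos_gens)
next
  fix x assume "x \<in> range pos"
  then obtain w where "x = pos w" by blast
  moreover have "pos w \<in> artin_M m"
  proof (induction w)
    case Nil
    then show ?case by (simp add: artin_M_def generate_monoid.one)
  next
    case (Cons y w)
    have "pos [y] \<in> artin_M m"
      unfolding artin_M_def pos_gens by (cases y) (auto intro: generate_monoid.incl)
    with Cons show ?case unfolding pos_Cons[of y w] artin_M_def by (auto intro: generate_monoid.mult)
  qed
  ultimately show "x \<in> artin_M m" by simp
qed

definition K :: "I2_gen \<Rightarrow> I2_gen word set set" where
  "K c = range (\<lambda>n. pos (replicate n c))"

lemma K_eq: "generate_monoid G {pos [c]} = K c"
proof (intro equalityI subsetI)
  fix x assume "x \<in> generate_monoid G {pos [c]}"
  then show "x \<in> K c"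
  proof (induction rule: generate_monoid.induct)
    case one
    have "\<one>\<^bsub>G\<^esub> = pos (replicate 0 c)" by simp
    then show ?case unfolding K_def by blast
  next
    case (incl x)
    then have "x = pos (replicate 1 c)" by simp
    then show ?case unfolding K_def by blast
  next
    case (mult x y)
    then obtain i j where "x = pos (replicate i c)" "y = pos (replicate j c)" unfolding K_def by blast
    then have "x \<cdot> y = pos (replicate (i + j) c)" by (simp add: replicate_add pos_append)
    then show ?case unfolding K_def by blast
  qed
next
  fix x assume "x \<in> K c"
  then obtain n where "x = pos (replicate n c)" unfolding K_def by blast
  moreover have "pos (replicate n c) \<in> generate_monoid G {pos [c]}"
  proof (induction n)
    case 0
    then show ?case by (simp add: generate_monoid.one)
  next
    case (Suc n)
    show ?case unfolding replicate_Suc pos_Cons[of c "replicate n c"]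
      by (intro generate_monoid.mult generate_monoid.incl Suc) simp
  qed
  ultimately show "x \<in> generate_monoid G {pos [c]}" by simp
qed

lemma M1_eq: "artin_M1 m = K Gen_t" and N_eq: "artin_N m = K Gen_s"
  by (simp_all add: artin_M1_def artin_N_def pos_gens K_eq)

section \<open>\<Delta>-forms and divisibility read off from the action\<close>

lemma state_reduced: "reduced m w \<Longrightarrow> (w, j) \<in> i2_states m" by (simp add: i2_states_def)

lemma reduced_Nil_m [simp]: "reduced m []" using k by simp

lemma act_pos: "reduced m w \<Longrightarrow> i2.act (pos u) (w, j) = fold (i2_step m) (positive_word u) (w, j)"
  unfolding pos_def by (rule i2.act_word_class[OF pos_word state_reduced])

lemma act_letter: "st \<in> i2_states m \<Longrightarrow> i2.act (letter l) st = i2_step m l st"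
  unfolding letter_eq using i2.act_word_class[of "[l]" st] by simp

lemma act_reduced: "reduced m u \<Longrightarrow> i2.act (pos u) ([], j) = (rev u, j)"
  using fold_push[of u "[]" j] by (simp add: act_pos)

lemma act_Delta: "reduced m w \<Longrightarrow> i2.act \<Delta> (w, j) = (w, j + 1)"
  unfolding Delta_eq[of Gen_s] using fold_alternating[of w Gen_s j] act_pos[of w _ j] by simp

text \<open>Only negative letters lower the exponent. A drop of the exponent thus shows that an
  element is not in the monoid.\<close>

lemma act_pos_mono:
  "st \<in> i2_states m \<Longrightarrow> snd (i2.act (pos u) st) \<ge> snd st"
proof (induction u arbitrary: st)
  case Nil
  then show ?case by (simp add: act_one)
next
  case (Cons x u)
  obtain w j where st: "st = (w, j)" by force
  let ?st = "i2_step m (x, True) st"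
  have "i2.act (pos (x # u)) st = i2.act (pos u) (i2.act (letter (x, True)) st)"
    unfolding pos_Cons[of x u] using act_mult[OF pos_closed pos_closed Cons.prems] by (simp add: letter_def)
  then have "i2.act (pos (x # u)) st = i2.act (pos u) ?st" by (simp only: act_letter[OF Cons.prems])
  moreover have "?st \<in> i2_states m" using Cons.prems by (intro i2.step_closed) simp_all
  moreover have "snd ?st \<ge> snd st" by (simp add: st)
  ultimately show ?case using Cons.IH[of ?st] by simp
qed

text \<open>Recovers the group element from a state; with \<open>val_act\<close> the orbit of
  \<open>([], 0)\<close> becomes a normal form.\<close>

definition val :: "I2_gen list \<times> int \<Rightarrow> I2_gen word set" where
  "val st = pos (rev (fst st)) \<cdot> (\<Delta> [^]\<^bsub>G\<^esub> snd st)"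

lemma val_closed [simp]: "val st \<in> carrier G" by (simp add: val_def)

lemma val_push: "val (i2_step m (x, True) (w, j)) = val (w, j) \<cdot> pos [x]"
proof (cases "take (m - 1) w = alt (other x) (m - 1)")
  case True
  then have w: "rev w = rev (drop (m - 1) w) @ alt (other x) (m - 1)"
  proof -
    have "odd (m - 1)" using k by simp
    then have "rev (alt (other x) (m - 1)) = alt (other x) (m - 1)" by (simp add: rev_alternating)
    then show ?thesis using True by (metis append_take_drop_id rev_append)
  qed
  have "pos (rev w) \<cdot> pos [x] = pos (rev (drop (m - 1) w)) \<cdot> \<Delta>"
    unfolding w Delta_eq[of "other x"] using alt_m(2)[of "other x"] by (simp flip: pos_append)
  moreover have "\<Delta> [^]\<^bsub>G\<^esub> (j + 1) = \<Delta> \<cdot> (\<Delta> [^]\<^bsub>G\<^esub> j)"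
    using G.int_pow_mult[of \<Delta> 1 j] by (simp add: add.commute)
  ultimately have "pos (rev (drop (m - 1) w)) \<cdot> (\<Delta> [^]\<^bsub>G\<^esub> (j + 1)) = pos (rev w) \<cdot> pos [x] \<cdot> (\<Delta> [^]\<^bsub>G\<^esub> j)"
    by (simp add: G.m_assoc)
  also have "\<dots> = val (w, j) \<cdot> pos [x]"
    using Delta_pow_central[of "pos [x]" j] by (simp add: val_def G.m_assoc)
  finally show ?thesis using True by (simp add: val_def)
next
  case False
  then show ?thesis
    using Delta_pow_central[of "pos [x]" j] by (simp add: val_def pos_append G.m_assoc)
qed

lemma val_step:
  assumes "st \<in> i2_states m"
  shows "val (i2_step m l st) = val st \<cdot> letter l"
proof -
  obtain x e where l: "l = (x, e)" by force
  show ?thesis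
  proof (cases e)
    case True
    then show ?thesis using val_push by (cases st) (simp add: l letter_def)
  next
    case False
    let ?st = "i2_step m l st"
    have "i2_step m (x, True) ?st = st" using i2.step_cancel[OF UNIV_I assms, of x False] False l by simp
    then have "val st = val ?st \<cdot> pos [x]" using val_push by (metis prod.exhaust)
    then show ?thesis using False by (simp add: l letter_def G.m_assoc)
  qed
qed

lemma val_act: "g \<in> carrier G \<Longrightarrow> val (i2.act g ([], 0)) = g"
proof (induction rule: carrier_induct)
  case one
  then show ?case by (simp add: act_one state_reduced val_def)
next
  case (mult l h)
  have "([], 0) \<in> i2_states m" by (simp add: state_reduced)
  then show ?case using mult by (simp add: act_mult act_letter val_step act_closed)
qed

text \<open>In the action the inverse of \<open>c\<close> finds no letter to cancel and lowers the
  exponent from 0 to -1, which no positive word does. One \<open>c\<close> is enough for this; the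
  other copies are absorbed into the supposed positive quotient.\<close>

lemma not_M:
  assumes "reduced m w" "w = [] \<or> last w \<noteq> c" "n \<ge> 1"
  shows "pos w \<cdot> inv\<^bsub>G\<^esub> pos (replicate n c) \<notin> range pos"
proof
  assume "pos w \<cdot> inv\<^bsub>G\<^esub> pos (replicate n c) \<in> range pos"
  then obtain v where "pos w \<cdot> inv\<^bsub>G\<^esub> pos (replicate n c) = pos v" by blast
  then have "pos w = pos v \<cdot> pos (replicate n c)" by (metis G.inv_solve_right pos_closed)
  moreover have "replicate n c = replicate (n - 1) c @ [c]" using assms(3) by (cases n) (simp_all add: replicate_append_same)
  ultimately have "pos w = pos (v @ replicate (n - 1) c) \<cdot> letter (c, True)"
    by (simp add: pos_append letter_def G.m_assoc)
  then have eq: "pos w \<cdot> letter (c, False) = pos (v @ replicate (n - 1) c)"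
    by (simp add: letter_def G.m_assoc)
  have st: "([], 0) \<in> i2_states m" "(rev w, 0) \<in> i2_states m" using assms(1) by (simp_all add: state_reduced)
  have "i2.act (pos w \<cdot> letter (c, False)) ([], 0) = i2_step m (c, False) (rev w, 0)"
    using assms st by (simp add: act_mult act_letter act_reduced)
  also have "snd \<dots> = - 1" using assms(2) by (auto simp: hd_rev)
  finally show False using act_pos_mono[OF st(1), of "v @ replicate (n - 1) c"] eq by simp
qed

lemma exists_Delta_form:
  assumes "g \<in> carrier G"
  obtains w j where "reduced m w" "g = pos w \<cdot> (\<Delta> [^]\<^bsub>G\<^esub> (j::int))" "unmovable G (artin_M m) \<Delta> (pos w)"
proof -
  obtain w j where wj: "i2.act g ([], 0) = (w, j)" by force
  have st: "([], 0) \<in> i2_states m" by (simp add: state_reduced)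
  from act_closed[OF assms this] wj have w: "reduced m w" by (simp add: i2_states_def)
  have "g = pos (rev w) \<cdot> (\<Delta> [^]\<^bsub>G\<^esub> j)" using val_act[OF assms] wj by (simp add: val_def)
  moreover have "unmovable G (artin_M m) \<Delta> (pos (rev w))"
    unfolding unmovable_def le_R_def M_eq
  proof (intro conjI notI)
    assume "pos (rev w) \<cdot> inv\<^bsub>G\<^esub> \<Delta> \<in> range pos"
    then obtain v where "pos (rev w) \<cdot> inv\<^bsub>G\<^esub> \<Delta> = pos v" by blast
    then have "pos (rev w) = pos v \<cdot> \<Delta>" by (metis G.inv_solve_right pos_closed Delta_closed)
    \<comment> \<open>A divisor \<Delta> moved to the front raises the exponent to at least 1,
      whereas pushing the reduced word leaves it at 0.\<close>
    then have eq: "pos (rev w) = \<Delta> \<cdot> pos v" by (simp add: Delta_central)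
    have "i2.act (\<Delta> \<cdot> pos v) ([], 0) = i2.act (pos v) ([], 1)"
      using st by (simp add: act_mult act_Delta)
    then have "snd (i2.act (\<Delta> \<cdot> pos v) ([], 0)) \<ge> 1" using act_pos_mono[of "([], 1)" v] by (simp add: state_reduced)
    with eq act_reduced[of "rev w" 0] w show False by simp
  qed simp
  ultimately show ?thesis using that[of "rev w" j] w by simp
qed

lemma unmovable_reduced:
  assumes "unmovable G (artin_M m) \<Delta> (pos w)"
  shows "reduced m w"
  unfolding reduced_def
proof (intro allI notI)
  fix p q x assume "w = p @ alt x m @ q"
  then have "pos w = pos p \<cdot> (\<Delta> \<cdot> pos q)" by (simp add: pos_append Delta_eq[of x])
  then have "pos w = pos (p @ q) \<cdot> \<Delta>" using Delta_central[of "pos q"] by (simp add: pos_append G.m_assoc)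
  then have "pos w \<cdot> inv\<^bsub>G\<^esub> \<Delta> = pos (p @ q)" by (simp add: G.m_assoc)
  then show False using assms unfolding unmovable_def le_R_def M_eq by simp
qed

text \<open>The length homomorphism to the integers, written as an action by translations. It makes
  the empty word the only positive word for the identity.\<close>

definition length_step :: "I2_gen \<times> bool \<Rightarrow> int \<Rightarrow> int" where
  "length_step l n = (if snd l then n + 1 else n - 1)"

lemma fold_length_step: "fold length_step (positive_word w) n = n + int (length w)"
  by (induction w arbitrary: n) (auto simp: positive_word_def length_step_def)

sublocale len: word_action UNIV "artin_I2_rels m" length_step UNIV
proof
  fix a b :: "I2_gen word" and x :: int
  assume "(a, b) \<in> artin_I2_rels m"
  then show "fold length_step a x = fold length_step b x"
    by (auto simp: artin_I2_rels_def fold_length_step)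
qed (auto simp: length_step_def)

lemma pos_length: "pos u = pos v \<Longrightarrow> length u = length v"
  using len.act_word_class[OF pos_word UNIV_I, of u 0] len.act_word_class[OF pos_word UNIV_I, of v 0]
  by (simp add: pos_def fold_length_step)

lemma pos_eq_one: "pos u = \<one>\<^bsub>G\<^esub> \<longleftrightarrow> u = []"
  using pos_length[of u "[]"] by auto

lemma list_prod_one:
  assumes "set xs \<subseteq> range pos" "list_prod G xs = \<one>\<^bsub>G\<^esub>" "x \<in> set xs"
  shows "x = \<one>\<^bsub>G\<^esub>"
  using assms
proof (induction xs)
  case (Cons y ys)
  have "\<exists>v. list_prod G ys = pos v" using Cons.prems(1)
  proof (induction ys)
    case Nil
    then show ?case by (metis list_prod_Nil pos_Nil)
  next
    case (Cons z zs)
    then show ?case by (auto simp flip: pos_append)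
  qed
  then obtain u v where uv: "y = pos u" "list_prod G ys = pos v" using Cons.prems(1) by auto
  with Cons.prems(2) have "pos (u @ v) = \<one>\<^bsub>G\<^esub>" by (simp add: pos_append)
  then have "u = []" "v = []" by (simp_all add: pos_eq_one)
  with uv Cons show ?case by auto
qed simp

section \<open>Depth\<close>

lemma M_closed: "a \<in> artin_M m \<Longrightarrow> a \<in> carrier G"
  by (auto simp: M_eq)

lemma replicate_le: "i \<le> j \<Longrightarrow> replicate j c = replicate (j - i) c @ replicate i c"
  by (simp flip: replicate_add)

text \<open>For \<open>n > e\<close> the common power of \<open>c\<close> cancels and
  \<open>not_M\<close> applies to what remains.\<close>

lemma le_R_replicate:
  assumes "reduced m w" "w = [] \<or> last w \<noteq> c"
  shows "le_R G (artin_M m) (pos (replicate n c)) (pos (w @ replicate e c)) \<longleftrightarrow> n \<le> e"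
proof (cases "n \<le> e")
  case True
  then have "pos (w @ replicate e c) \<cdot> inv\<^bsub>G\<^esub> pos (replicate n c) = pos (w @ replicate (e - n) c)"
    by (simp add: replicate_le[of n e] pos_append G.m_assoc)
  with True show ?thesis by (simp add: le_R_def M_eq)
next
  case False
  then have "pos (replicate n c) = pos (replicate (n - e) c) \<cdot> pos (replicate e c)"
    using replicate_le[of e n c] by (simp flip: pos_append)
  then have "pos (w @ replicate e c) \<cdot> inv\<^bsub>G\<^esub> pos (replicate n c) = pos w \<cdot> inv\<^bsub>G\<^esub> pos (replicate (n - e) c)"
    by (simp add: pos_append G.m_assoc G.inv_mult_group G.inv_cancel_left)
  with False show ?thesis using not_M[OF assms, of "n - e"] by (simp add: le_R_def M_eq)
qed

lemma tail_eq:
  assumes "reduced m w" "w = [] \<or> last w \<noteq> c"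
  shows "tail G (artin_M m) (K c) (pos (w @ replicate e c)) = pos (replicate e c)"
  unfolding tail_def
proof (rule the_equality)
  let ?le = "le_R G (artin_M m)"
  have b: "?le (pos (replicate n c)) (pos (replicate i c)) \<longleftrightarrow> n \<le> i" for n i
    using le_R_replicate[of "[]" c n i] by simp
  show "pos (replicate e c) \<in> K c \<and> {x \<in> K c. ?le x (pos (w @ replicate e c))} = {x \<in> K c. ?le x (pos (replicate e c))}"
    using le_R_replicate[OF assms] b by (auto simp: K_def)
  fix x assume x: "x \<in> K c \<and> {y \<in> K c. ?le y (pos (w @ replicate e c))} = {y \<in> K c. ?le y x}"
  then obtain i where i: "x = pos (replicate i c)" unfolding K_def by blast
  have "n \<le> e \<longleftrightarrow> n \<le> i" for n
  proof -
    have "pos (replicate n c) \<in> K c" unfolding K_def by blast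
    then show ?thesis using x i le_R_replicate[OF assms] b by blast
  qed
  then have "e = i" by (meson order.antisym order_refl)
  then show "x = pos (replicate e c)" using i by simp
qed

text \<open>Either generator may take the odd positions here: stripping the rightmost factor
  exchanges the two roles, so the induction runs over both. The choice \<open>Gen_t\<close> is the
  form that defines depth.\<close>

definition alt_form :: "I2_gen \<Rightarrow> I2_gen word set \<Rightarrow> nat \<Rightarrow> (nat \<Rightarrow> I2_gen word set) \<Rightarrow> bool" where
  "alt_form c a p x \<longleftrightarrow> p \<ge> 1 \<and> (\<forall>i\<in>{1..p}. x i \<in> artin_M m) \<and> a = list_prod G (map x (rev [1..<Suc p])) \<and>
     x p \<noteq> \<one>\<^bsub>G\<^esub> \<and>
     (\<forall>i\<in>{1..p}. x i = tail G (artin_M m) (if odd i then K c else K (other c)) (list_prod G (map x (rev [i..<Suc p]))))"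

lemma alternating_form_iff: "alternating_form G (artin_M m) (artin_M1 m) (artin_N m) = alt_form Gen_t"
  unfolding alternating_form_def alt_form_def fun_eq_iff M1_eq N_eq by simp

text \<open>A new rightmost factor becomes the first one and raises all other indices by one. This
  flips their parity and so exchanges \<open>c\<close> and \<open>other c\<close>.\<close>

lemma alt_form_shift:
  assumes a: "alt_form (other c) a p x" and y: "y \<in> artin_M m" "y = tail G (artin_M m) (K c) (a \<cdot> y)"
  shows "alt_form c (a \<cdot> y) (Suc p) (\<lambda>i. if i = 1 then y else x (i - 1))" (is "alt_form _ _ _ ?x")
proof -
  have a: "1 \<le> p" "\<forall>i\<in>{1..p}. x i \<in> artin_M m" "a = list_prod G (map x (rev [1..<Suc p]))" "x p \<noteq> \<one>\<^bsub>G\<^esub>"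
    "\<forall>i\<in>{1..p}. x i = tail G (artin_M m) (if odd i then K (other c) else K (other (other c)))
       (list_prod G (map x (rev [i..<Suc p])))"
    using a unfolding alt_form_def by blast+
  have x: "x i \<in> carrier G" if "i \<in> {1..p}" for i
    using a(2) that M_closed by blast
  have shift: "map ?x (rev [Suc i..<Suc (Suc p)]) = map x (rev [i..<Suc p])" if "i \<ge> 1" for i
    using that unfolding map_Suc_upt[symmetric] rev_map map_map by (intro map_cong) auto
  have "[1..<Suc (Suc p)] = 1 # [Suc 1..<Suc (Suc p)]" by (rule upt_conv_Cons) simp
  then have "map ?x (rev [1..<Suc (Suc p)]) = map x (rev [1..<Suc p]) @ [y]"
    using shift[of 1] by (simp del: upt_Suc)
  moreover have "set (map x (rev [1..<Suc p])) \<subseteq> carrier G" using x by auto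
  ultimately have full: "list_prod G (map ?x (rev [1..<Suc (Suc p)])) = a \<cdot> y"
  proof -
    assume 1: "map ?x (rev [1..<Suc (Suc p)]) = map x (rev [1..<Suc p]) @ [y]"
      and 2: "set (map x (rev [1..<Suc p])) \<subseteq> carrier G"
    have yc: "y \<in> carrier G" using y(1) M_eq by auto
    from a(3) show ?thesis unfolding 1 using G.list_prod_append[OF 2, of "[y]"] yc by simp
  qed
  show ?thesis unfolding alt_form_def
  proof (intro conjI ballI)
    show "1 \<le> Suc p" by simp
    show "a \<cdot> y = list_prod G (map ?x (rev [1..<Suc (Suc p)]))" using full ..
    show "?x (Suc p) \<noteq> \<one>\<^bsub>G\<^esub>" using a(1,4) by simp
    fix i assume i: "i \<in> {1..Suc p}"
    have "i - 1 \<in> {1..p}" if "i \<noteq> 1" using i that unfolding atLeastAtMost_iff by linarith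
    then show "?x i \<in> artin_M m" using a(2) y(1) by simp
    show "?x i = tail G (artin_M m) (if odd i then K c else K (other c)) (list_prod G (map ?x (rev [i..<Suc (Suc p)])))"
    proof (cases "i = 1")
      case True
      then show ?thesis using full y(2)[symmetric] by (simp del: upt_Suc)
    next
      case False
      then obtain i' where i': "i = Suc i'" "i' \<in> {1..p}" using i by (cases i) auto
      then have "x i' = tail G (artin_M m) (if odd i' then K (other c) else K c) (list_prod G (map x (rev [i'..<Suc p])))"
        using a(5) by (simp only: other_other)
      then show ?thesis using i' shift[of i'] by (simp del: upt_Suc)
    qed
  qed
qed

lemma split_last_block:
  assumes "w \<noteq> []"
  obtains u n where "w = u @ replicate n (last w)" "n \<ge> 1" "u = [] \<or> last u \<noteq> last w"
proof -
  define c where "c = last w"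
  have "takeWhile (\<lambda>x. x = c) (rev w) = replicate (length (takeWhile (\<lambda>x. x = c) (rev w))) c"
    by (rule replicate_eqI) (auto dest: set_takeWhileD)
  then obtain n where n: "takeWhile (\<lambda>x. x = c) (rev w) = replicate n c" by blast
  have "rev w = takeWhile (\<lambda>x. x = c) (rev w) @ dropWhile (\<lambda>x. x = c) (rev w)" by simp
  then have w: "w = rev (dropWhile (\<lambda>x. x = c) (rev w)) @ replicate n c"
    unfolding n by (metis rev_append rev_replicate rev_rev_ident)
  moreover have "n \<ge> 1"
  proof (rule ccontr)
    assume "\<not> n \<ge> 1"
    then have "takeWhile (\<lambda>x. x = c) (rev w) = []" using n by simp
    moreover have "rev w \<noteq> []" "hd (rev w) = c" using assms by (simp_all add: c_def hd_rev)
    ultimately show False by (cases "rev w") auto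
  qed
  moreover have "rev (dropWhile (\<lambda>x. x = c) (rev w)) = [] \<or> last (rev (dropWhile (\<lambda>x. x = c) (rev w))) \<noteq> c"
    using hd_dropWhile[of "\<lambda>x. x = c" "rev w"] by (auto simp: last_rev)
  ultimately show ?thesis using that unfolding c_def by blast
qed

text \<open>The factors are the maximal blocks of the word, peeled off from the right; the rightmost
  factor may be trivial only if it is a power of t. The s-blocks have even indices for
  \<open>c = Gen_t\<close> and odd indices for \<open>c = Gen_s\<close>, whence the two ways of
  halving.\<close>

lemma alt_form_exists:
  assumes "reduced m w" "w = [] \<or> last w \<noteq> c" "w \<noteq> [] \<or> e \<ge> 1" "c = Gen_s \<longrightarrow> e \<ge> 1"
  shows "\<exists>p x. alt_form c (pos (w @ replicate e c)) p x \<and>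
    (if c = Gen_s then Suc p else p) div 2 = s_blocks (w @ replicate e c)"
  using assms
proof (induction w arbitrary: c e rule: length_induct)
  case (1 w)
  have t: "tail G (artin_M m) (K c) (pos (w @ replicate e c)) = pos (replicate e c)"
    using 1(2,3) by (rule tail_eq)
  show ?case
  proof (cases "w = []")
    case True
    then have e: "e \<ge> 1" using 1 by simp
    then have "alt_form c (pos (w @ replicate e c)) 1 (\<lambda>_. pos (replicate e c))"
      using True t by (simp add: alt_form_def M_eq pos_eq_one)
    moreover have "s_blocks (w @ replicate e c) = (if c = Gen_s then 1 else 0)"
      using True e s_blocks_append_t[of "[]" e] s_blocks_append_s[of e "[]"] by (cases c) auto
    ultimately show ?thesis
      by (intro exI[of _ 1] exI[of _ "\<lambda>_. pos (replicate e c)"]) auto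
  next
    case False
    then have l: "last w = other c" using 1(3) by (simp add: neq_iff_other)
    obtain u n where u: "w = u @ replicate n (other c)" "n \<ge> 1" "u = [] \<or> last u \<noteq> other c"
      using split_last_block[OF False] unfolding l .
    have "length u < length w" "reduced m u" using u 1(2) reduced_appendD(1) by auto
    then obtain p x where x: "alt_form (other c) (pos w) p x"
      "(if other c = Gen_s then Suc p else p) div 2 = s_blocks w"
      using 1(1) u(2,3) unfolding u(1) by blast
    have "alt_form c (pos w \<cdot> pos (replicate e c)) (Suc p) (\<lambda>i. if i = 1 then pos (replicate e c) else x (i - 1))"
      using x(1) t by (intro alt_form_shift) (auto simp: M_eq pos_append)
    moreover have "(if c = Gen_s then Suc (Suc p) else Suc p) div 2 = s_blocks (w @ replicate e c)"
      using x(2) 1(3,5) s_blocks_append_t[of w e] s_blocks_append_s[of e w] by (cases c) auto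
    ultimately show ?thesis unfolding pos_append by blast
  qed
qed

text \<open>Each factor is the tail of the product of the factors not yet removed, so two forms
  agree from the right and cancel factor by factor. A longer form would leave a trivial product of
  positive elements that includes \<open>y q\<close>, forcing \<open>y q\<close> to be
  trivial.\<close>

lemma alt_form_unique_le:
  assumes "alt_form c a p x" "alt_form c a q y"
  shows "q \<le> p"
proof (rule ccontr)
  assume "\<not> q \<le> p"
  then have q: "p < q" by simp
  have x: "\<forall>i\<in>{1..p}. x i \<in> artin_M m" "a = list_prod G (map x (rev [1..<Suc p]))"
    "\<And>i. i \<in> {1..p} \<Longrightarrow> x i = tail G (artin_M m) (if odd i then K c else K (other c)) (list_prod G (map x (rev [i..<Suc p])))"
    using assms(1) unfolding alt_form_def by blast+
  have y: "\<forall>i\<in>{1..q}. y i \<in> artin_M m" "a = list_prod G (map y (rev [1..<Suc q]))" "y q \<noteq> \<one>\<^bsub>G\<^esub>"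
    "\<And>i. i \<in> {1..q} \<Longrightarrow> y i = tail G (artin_M m) (if odd i then K c else K (other c)) (list_prod G (map y (rev [i..<Suc q])))"
    using assms(2) unfolding alt_form_def by blast+
  have xc: "x i \<in> carrier G" if "i \<in> {1..p}" for i
    using x(1) that M_closed by blast
  have yc: "y i \<in> carrier G" if "i \<in> {1..q}" for i
    using y(1) that M_closed by blast
  have split: "list_prod G (map z (rev [Suc i..<Suc r])) \<in> carrier G"
    "list_prod G (map z (rev [Suc i..<Suc r])) = list_prod G (map z (rev [Suc (Suc i)..<Suc r])) \<cdot> z (Suc i)"
    if "Suc i \<le> r" "\<And>i. i \<in> {1..r} \<Longrightarrow> z i \<in> carrier G" for z r i
  proof -
    have c: "set (map z (rev [j..<Suc r])) \<subseteq> carrier G" if "j \<ge> 1" for j using that \<open>\<And>i. i \<in> {1..r} \<Longrightarrow> z i \<in> carrier G\<close> by auto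
    show "list_prod G (map z (rev [Suc i..<Suc r])) \<in> carrier G" using c[of "Suc i"] by (intro G.list_prod_closed) simp
    have "[Suc i..<Suc r] = Suc i # [Suc (Suc i)..<Suc r]" using that(1) by (intro upt_conv_Cons) simp
    then show "list_prod G (map z (rev [Suc i..<Suc r])) = list_prod G (map z (rev [Suc (Suc i)..<Suc r])) \<cdot> z (Suc i)"
      using c[of "Suc (Suc i)"] that by (simp add: G.list_prod_append del: upt_Suc)
  qed
  have "list_prod G (map x (rev [Suc i..<Suc p])) = list_prod G (map y (rev [Suc i..<Suc q]))" if "i \<le> p" for i
    using that
  proof (induction i)
    case 0
    show ?case using x(2) y(2) unfolding One_nat_def by (rule subst)
  next
    case (Suc i)
    have IH: "list_prod G (map x (rev [Suc i..<Suc p])) = list_prod G (map y (rev [Suc i..<Suc q]))"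
      using Suc by simp
    have i: "Suc i \<in> {1..p}" "Suc i \<in> {1..q}" using Suc q by auto
    have xy: "x (Suc i) = y (Suc i)"
      by (subst x(3)[OF i(1)], subst y(4)[OF i(2)], subst IH) (rule HOL.refl)
    have "set (map z (rev [Suc (Suc i)..<Suc r])) \<subseteq> carrier G" if "\<And>i. i \<in> {1..r} \<Longrightarrow> z i \<in> carrier G" for z r
      using that by auto
    then have "list_prod G (map x (rev [Suc (Suc i)..<Suc p])) \<in> carrier G" "list_prod G (map y (rev [Suc (Suc i)..<Suc q])) \<in> carrier G"
      using xc yc by (metis G.list_prod_closed)+
    moreover have "list_prod G (map x (rev [Suc (Suc i)..<Suc p])) \<cdot> y (Suc i) = list_prod G (map y (rev [Suc (Suc i)..<Suc q])) \<cdot> y (Suc i)"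
      using IH split(2)[of i p x] split(2)[of i q y] i xc yc xy by simp
    ultimately show ?case using yc[OF i(2)] G.right_cancel by blast
  qed
  from this[of p] have "list_prod G (map y (rev [Suc p..<Suc q])) = \<one>\<^bsub>G\<^esub>" by simp
  moreover have "set (map y (rev [Suc p..<Suc q])) \<subseteq> range pos"
    using y(1) unfolding M_eq by auto
  moreover have "y q \<in> set (map y (rev [Suc p..<Suc q]))" using q by auto
  ultimately have "y q = \<one>\<^bsub>G\<^esub>" using list_prod_one by blast
  then show False using y(3) by contradiction
qed

section \<open>Depth as a block count, and complements in powers of \<Delta>\<close>

abbreviation "depth \<equiv> dpt G (artin_M m) (artin_M1 m) (artin_N m)"

text \<open>Only the part before the trailing letters t has to be reduced, so this also covers
  powers of \<Delta>, which are not unmovable.\<close>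

lemma depth_append:
  assumes "reduced m w" "w = [] \<or> last w = Gen_s"
  shows "depth (pos (w @ replicate e Gen_t)) = s_blocks w"
proof (cases "w = [] \<and> e = 0")
  case True
  \<comment> \<open>The identity has breadth 1 by convention, hence depth 0.\<close>
  then show ?thesis by (simp add: dpt_def bh_def)
next
  case False
  then obtain p x where p: "alt_form Gen_t (pos (w @ replicate e Gen_t)) p x" "p div 2 = s_blocks (w @ replicate e Gen_t)"
    using alt_form_exists[of w Gen_t e] assms by auto
  have "(THE p. \<exists>x. alt_form Gen_t (pos (w @ replicate e Gen_t)) p x) = p"
    using p(1) alt_form_unique_le by (intro the_equality) (auto intro: order.antisym)
  then have "bh G (artin_M m) (artin_M1 m) (artin_N m) (pos (w @ replicate e Gen_t)) = p"
    using False by (auto simp: bh_def alternating_form_iff pos_eq_one)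
  \<comment> \<open>Both parity cases in the definition of depth amount to
    \<open>p div 2\<close>.\<close>
  then show ?thesis using p(2) by (auto simp: dpt_def s_blocks_append_t elim!: oddE)
qed

lemma depth_reduced:
  assumes "reduced m w"
  shows "depth (pos w) = s_blocks w"
proof (cases "w = [] \<or> last w = Gen_s")
  case True
  then show ?thesis using depth_append[OF assms True, of 0] by simp
next
  case False
  then have l: "last w = Gen_t" by (cases "last w") auto
  obtain u n where u: "w = u @ replicate n Gen_t" "u = [] \<or> last u \<noteq> Gen_t"
    using split_last_block[of w] False unfolding l by blast
  then have "reduced m u" "u = [] \<or> last u = Gen_s" using assms reduced_appendD(1) by (auto simp: neq_iff_other)
  from depth_append[OF this] show ?thesis unfolding u(1) by (simp add: s_blocks_append_t)
qed

text \<open>Each copy of \<open>alt Gen_s (m - 1)\<close> is \<Delta> without its last letter t, so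
  by centrality the word represents \<Delta>^j t^{-j}.\<close>

fun t_complement :: "nat \<Rightarrow> I2_gen list" where
  "t_complement 0 = []"
| "t_complement (Suc j) = alt Gen_s (m - 1) @ t_complement j"

lemma alt_s_last: "alt Gen_s (m - 1) \<noteq> []" "last (alt Gen_s (m - 1)) = Gen_s" "hd (alt Gen_s (m - 1)) = Gen_s"
proof -
  have m: "m - 1 = Suc (m - 2)" "even (m - 2)" using k by auto
  show "alt Gen_s (m - 1) \<noteq> []" "last (alt Gen_s (m - 1)) = Gen_s" "hd (alt Gen_s (m - 1)) = Gen_s"
    unfolding m(1) using m(2) by (simp, simp only: alternating_snoc last_snoc if_True, simp)
qed

text \<open>Consecutive copies meet in a double s. This keeps the word reduced and merges blocks:
  \<open>j\<close> copies with \<open>k\<close> blocks each meet at \<open>j - 1\<close> junctions,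
  which leaves \<open>j * (k - 1) + 1\<close>.\<close>

lemma t_complement_props:
  "reduced m (t_complement j) \<and> (j \<ge> 1 \<longrightarrow> t_complement j \<noteq> [] \<and> hd (t_complement j) = Gen_s \<and> last (t_complement j) = Gen_s
     \<and> s_blocks (t_complement j) = j * (k - 1) + 1)"
proof (induction j)
  case (Suc j)
  let ?w = "t_complement j"
  have w: "?w = [] \<or> hd ?w = Gen_s \<and> j \<ge> 1" using Suc by (cases j) auto
  have "reduced m (t_complement (Suc j))"
    using reduced_alternating_append[of "m - 1" m ?w Gen_s] w Suc k by auto
  moreover have "last (t_complement (Suc j)) = Gen_s"
    using alt_s_last Suc by (cases j) (auto simp: last_append)
  moreover have "s_blocks (t_complement (Suc j)) = Suc j * (k - 1) + 1"
  proof -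
    have m: "m - 1 = Suc (2 * (k - 1))" using k by simp
    have "s_blocks (t_complement (Suc j)) = k - 1 + s_blocks (Gen_s # ?w)"
      unfolding t_complement.simps m other.simps by (rule s_blocks_alternating)
    also have "s_blocks (Gen_s # ?w) = j * (k - 1) + 1" using Suc w by (cases j) auto
    finally show ?thesis by simp
  qed
  ultimately show ?case using alt_s_last by (simp add: hd_append)
qed simp

lemma Delta_pow: "\<Delta> [^]\<^bsub>G\<^esub> (int j) = pos (t_complement j @ replicate j Gen_t)"
proof (induction j)
  case (Suc j)
  have "pos (t_complement (Suc j) @ replicate (Suc j) Gen_t) =
    pos (alt Gen_s (m - 1)) \<cdot> (pos (t_complement j @ replicate j Gen_t) \<cdot> pos [Gen_t])"
    unfolding replicate_Suc by (simp add: pos_append G.m_assoc flip: replicate_append_same)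
  also have "\<dots> = pos (alt Gen_s (m - 1)) \<cdot> (pos [Gen_t] \<cdot> (\<Delta> [^]\<^bsub>G\<^esub> (int j)))"
    unfolding Suc[symmetric] by (simp add: Delta_pow_central)
  also have "\<dots> = \<Delta> \<cdot> (\<Delta> [^]\<^bsub>G\<^esub> (int j))"
    using alt_m(2)[of Gen_s] by (simp add: Delta_eq[of Gen_s] pos_append G.m_assoc)
  also have "\<dots> = \<Delta> [^]\<^bsub>G\<^esub> (int (Suc j))" using G.int_pow_mult[of \<Delta> 1 "int j"] by simp
  finally show ?case ..
qed simp

lemma depth_Delta_pow:
  assumes "j \<ge> (1::int)"
  shows "depth (\<Delta> [^]\<^bsub>G\<^esub> j) = nat j * (k - 1) + 1"
proof -
  have j: "j = int (nat j)" "nat j \<ge> 1" using assms by auto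
  show ?thesis
    by (subst j(1)) (use t_complement_props[of "nat j"] j(2) depth_append in \<open>simp only: Delta_pow; simp\<close>)
qed

text \<open>The word is inverted letter by letter, \<open>y\<close> being its last letter and y^{-1}
  being \<open>alt (other y) (m - 1)\<close> times \<Delta>^{-1}. A repeated letter prepends a new
  run of this kind; an alternating letter cancels the first letter of the current run. Here
  \<open>r\<close> letters of the newest run are left, and the \<open>take\<close> clause records
  the \<open>m - r\<close> letters responsible for that. Both moves preserve the balance of
  s-blocks.\<close>

lemma complement:
  assumes "reduced m (y # v)"
  shows "\<exists>l r c. l \<ge> 1 \<and> 1 \<le> r \<and> r < m \<and> take (m - r) (y # v) = alt y (m - r) \<and>
    inv\<^bsub>G\<^esub> pos (rev (y # v)) = pos (alt (other y) r @ c) \<cdot> (\<Delta> [^]\<^bsub>G\<^esub> (- int l)) \<and>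
    s_blocks (y # v) + s_blocks (alt (other y) r @ c) = l * (k - 1) + 1"
  using assms
proof (induction v arbitrary: y)
  have inv_letter: "inv\<^bsub>G\<^esub> pos [y] = pos (alt (other y) (m - 1)) \<cdot> (\<Delta> [^]\<^bsub>G\<^esub> (- 1 :: int))" for y
  proof -
    have "pos [y] \<cdot> pos (alt (other y) (m - 1)) = \<Delta>"
      using alt_m(1)[of y] by (simp add: Delta_eq[of y] flip: pos_append)
    from this[symmetric] have "inv\<^bsub>G\<^esub> pos [y] \<cdot> \<Delta> = pos (alt (other y) (m - 1))"
      by (simp only: G.inv_cancel_left pos_closed)
    from this[symmetric] show ?thesis using G.int_pow_neg[of \<Delta> 1] by (simp add: G.m_assoc)
  qed
  \<comment> \<open>Starting with t, the run has \<open>k - 1\<close> letters s and ends in t.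
    Starting with s it has \<open>k\<close> of them, the last of which merges with the first block
    of \<open>c\<close>.\<close>
  have s_blocks_alt: "s_blocks (alt (other y) (m - 1) @ c) = k - 1 + s_blocks c" if "c \<noteq> []" "hd c = other y" for c y
  proof -
    have m: "m - 1 = Suc (2 * (k - 1))" using k by simp
    show ?thesis unfolding m using that
      by (cases y) (simp_all only: other.simps s_blocks_alternating s_blocks.simps, simp_all)
  qed
  {
    case Nil
    have m: "m - 1 = Suc (2 * (k - 1))" using k by simp
    have "s_blocks [y] + s_blocks (alt (other y) (m - 1) @ []) = 1 * (k - 1) + 1"
      unfolding m by (cases y) (simp_all only: other.simps s_blocks_alternating, simp_all)
    moreover have "take (m - (m - 1)) [y] = alt y (m - (m - 1))" using k by simp
    ultimately show ?case using k inv_letter[of y]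
      by (intro exI[of _ 1] exI[of _ "m - 1"] exI[of _ "[]"]) simp
  next
    case (Cons x v)
    have red: "reduced m (x # v)" using Cons.prems by (rule reduced_ConsD)
    from Cons.IH[OF this] obtain l r c where lrc: "l \<ge> 1" "1 \<le> r" "r < m"
      "take (m - r) (x # v) = alt x (m - r)"
      "inv\<^bsub>G\<^esub> pos (rev (x # v)) = pos (alt (other x) r @ c) \<cdot> (\<Delta> [^]\<^bsub>G\<^esub> (- int l))"
      "s_blocks (x # v) + s_blocks (alt (other x) r @ c) = l * (k - 1) + 1" by blast
    obtain r' where r': "r = Suc r'" using lrc(2) by (cases r) auto
    let ?c = "alt (other x) r @ c"
    have c: "?c \<noteq> []" "hd ?c = other x" unfolding r' by simp_all
    have "inv\<^bsub>G\<^esub> pos (rev (y # x # v)) = inv\<^bsub>G\<^esub> pos [y] \<cdot> inv\<^bsub>G\<^esub> pos (rev (x # v))"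
      using pos_append[of "rev (x # v)" "[y]"] by (simp add: G.inv_mult_group)
    then have inv: "inv\<^bsub>G\<^esub> pos (rev (y # x # v)) = inv\<^bsub>G\<^esub> pos [y] \<cdot> pos ?c \<cdot> (\<Delta> [^]\<^bsub>G\<^esub> (- int l))"
      unfolding lrc(5) by (simp add: G.m_assoc)
    show ?case
    proof (cases "x = y")
      case True
      have "inv\<^bsub>G\<^esub> pos [y] \<cdot> pos ?c = pos (alt (other y) (m - 1) @ ?c) \<cdot> (\<Delta> [^]\<^bsub>G\<^esub> (- 1 :: int))"
        unfolding inv_letter pos_append[of _ ?c] by (simp add: G.m_assoc Delta_pow_central)
      moreover have "\<Delta> [^]\<^bsub>G\<^esub> (- int (Suc l)) = \<Delta> [^]\<^bsub>G\<^esub> (- 1 :: int) \<cdot> (\<Delta> [^]\<^bsub>G\<^esub> (- int l))"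
        using G.int_pow_mult[of \<Delta> "- 1" "- int l"] by simp
      ultimately have e1: "inv\<^bsub>G\<^esub> pos (rev (y # x # v)) = pos (alt (other y) (m - 1) @ ?c) \<cdot> (\<Delta> [^]\<^bsub>G\<^esub> (- int (Suc l)))"
        unfolding inv by (simp add: G.m_assoc)
      have e2: "take (m - (m - 1)) (y # x # v) = alt y (m - (m - 1))" using k by simp
      have e3: "s_blocks (y # x # v) + s_blocks (alt (other y) (m - 1) @ ?c) = Suc l * (k - 1) + 1"
      proof -
        have "s_blocks (y # x # v) = s_blocks (x # v)" using True by simp
        moreover have "s_blocks (alt (other y) (m - 1) @ ?c) = k - 1 + s_blocks ?c"
          by (rule s_blocks_alt) (use c True in simp_all)
        ultimately show ?thesis using lrc(6) mult_Suc[of l "k - 1"] by linarith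
      qed
      have e4: "1 \<le> m - 1" "m - 1 < m" using k by simp_all
      show ?thesis
        by (intro exI[of _ "Suc l"] exI[of _ "m - 1"] exI[of _ ?c] conjI e1 e2 e3 e4) simp
    next
      case False
      then have y: "y = other x" "x = other y" by (cases x; cases y; simp)+
      \<comment> \<open>With only one letter of the run left, \<open>y\<close> and the recorded
        alternating prefix would spell \<Delta> in a reduced word. So cancelling never exhausts the
        run.\<close>
      have "r \<noteq> 1"
      proof
        assume "r = 1"
        then have "take (m - 1) (x # v) = alt (other y) (m - 1)" using lrc(4) unfolding y(2)[symmetric] by (simp only:)
        then show False using Cons.prems reduced_m_Cons by blast
      qed
      then obtain r'' where r'': "r' = Suc r''" using r' by (cases r') auto
      have c': "?c = y # alt (other y) r' @ c" unfolding r' y(1) by simp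
      have "pos ?c = pos [y] \<cdot> pos (alt (other y) r' @ c)" unfolding c' by (rule pos_Cons)
      then have "inv\<^bsub>G\<^esub> pos [y] \<cdot> pos ?c = pos (alt (other y) r' @ c)" by (simp only: G.inv_cancel_left pos_closed)
      then have e1: "inv\<^bsub>G\<^esub> pos (rev (y # x # v)) = pos (alt (other y) r' @ c) \<cdot> (\<Delta> [^]\<^bsub>G\<^esub> (- int l))"
        unfolding inv by (simp only:)
      have "m - r' = Suc (m - r)" using r' lrc(3) by simp
      then have e2: "take (m - r') (y # x # v) = alt y (m - r')" using lrc(4) unfolding y(1) by simp
      \<comment> \<open>On both sides the neighbour of \<open>y\<close> is the other letter. So if
        \<open>y\<close> is s, exactly one block leaves the complement and one enters the
        word.\<close>
      have e3: "s_blocks (y # x # v) + s_blocks (alt (other y) r' @ c) = l * (k - 1) + 1"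
      proof -
        have "s_blocks ?c = s_blocks (alt (other y) r' @ c) + (if y = Gen_s then 1 else 0)"
          unfolding c' r'' by (cases y; simp)
        moreover have "s_blocks (y # x # v) = s_blocks (x # v) + (if y = Gen_s then 1 else 0)"
          unfolding y(2) by (cases y; simp)
        ultimately show ?thesis using lrc(6) by linarith
      qed
      have e4: "1 \<le> r'" "r' < m" using lrc(3) r' r'' by simp_all
      show ?thesis
        by (intro exI[of _ l] exI[of _ r'] exI[of _ c] conjI e1 e2 e3 e4 lrc(1))
    qed
  }
qed

end

section \<open>Comparison with the braid group\<close>

locale dihedral_braid = dihedral_artin +
  fixes \<iota> :: "I2_gen word set \<Rightarrow> nat word set"
  assumes iota_hom: "\<iota> \<in> hom (artin_I2 (2 * k)) (braid_group (2 * k))"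
    and iota_s: "\<iota> (artin_s (2 * k)) =
      list_prod (braid_group (2 * k)) (map (\<lambda>i. braid_gen (2 * k) (2 * i + 1)) [0..<k])"
    and iota_t: "\<iota> (artin_t (2 * k)) =
      list_prod (braid_group (2 * k)) (map (\<lambda>i. braid_gen (2 * k) (2 * i)) [1..<k])"
begin

abbreviation "B \<equiv> braid_group m"
abbreviation bmul (infixl "\<odot>" 70) where "x \<odot> y \<equiv> x \<otimes>\<^bsub>B\<^esub> y"
abbreviation "r \<equiv> braid_gen m"
abbreviation "Sub \<equiv> braid_sub m"
abbreviation "U \<equiv> Sub {2..m - 1}"
abbreviation "word is \<equiv> list_prod B (map r is)"

sublocale iota: group_hom G B \<iota>
  using iota_hom by unfold_locales

lemma m2: "m \<ge> 2" using k by simp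

lemma sub: "i \<ge> 1 \<Longrightarrow> j \<le> m - 1 \<Longrightarrow> subgroup (Sub {i..j}) B"
  by (rule braid_sub_subgroup) auto

lemma sub_carrier: "x \<in> Sub {i..j} \<Longrightarrow> i \<ge> 1 \<Longrightarrow> j \<le> m - 1 \<Longrightarrow> x \<in> carrier B"
  by (rule subgroup.mem_carrier[OF sub])

lemma sub_mult: "x \<in> Sub {i..j} \<Longrightarrow> y \<in> Sub {i..j} \<Longrightarrow> i \<ge> 1 \<Longrightarrow> j \<le> m - 1 \<Longrightarrow> x \<odot> y \<in> Sub {i..j}"
  by (rule subgroup.m_closed[OF sub])

lemma sub_inv: "x \<in> Sub {i..j} \<Longrightarrow> i \<ge> 1 \<Longrightarrow> j \<le> m - 1 \<Longrightarrow> inv\<^bsub>B\<^esub> x \<in> Sub {i..j}"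
  by (rule subgroup.m_inv_closed[OF sub])

lemma sub_one: "\<one>\<^bsub>B\<^esub> \<in> Sub I"
  unfolding braid_sub_def by (rule generate.one)

lemma sub_mono: "x \<in> Sub {i..j} \<Longrightarrow> i' \<le> i \<Longrightarrow> j \<le> j' \<Longrightarrow> x \<in> Sub {i'..j'}"
  using braid_sub_mono[of "{i..j}" "{i'..j'}"] by auto

lemma sub_commute:
  "x \<in> Sub {i..j} \<Longrightarrow> y \<in> Sub {i'..j'} \<Longrightarrow> i \<ge> 1 \<Longrightarrow> j + 2 \<le> i' \<Longrightarrow> j \<le> m - 1 \<Longrightarrow> j' \<le> m - 1 \<Longrightarrow> x \<odot> y = y \<odot> x"
  by (rule braid_sub_commute[of "{i..j}" m "{i'..j'}"]) auto

lemma word_in_sub: "set is \<subseteq> {i..j} \<Longrightarrow> word is \<in> Sub {i..j}"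
proof (induction "is")
  case (Cons a "is")
  then show ?case using braid_sub_gen[of a "{i..j}" m] by (auto simp: braid_sub_def intro: generate.eng)
qed (simp add: sub_one)

lemma word_append: "set is \<subseteq> {1..m - 1} \<Longrightarrow> set js \<subseteq> {1..m - 1} \<Longrightarrow> word (is @ js) = word is \<odot> word js"
  unfolding map_append by (rule braid.list_prod_append) (use braid_gen_closed in auto)

section \<open>Layers of braid generators and the light cone\<close>

definition layer :: "I2_gen \<Rightarrow> nat list" where
  "layer x = (if x = Gen_s then map (\<lambda>i. 2 * i + 1) [0..<k] else map (\<lambda>i. 2 * i) [1..<k])"

lemma layer_word: "\<iota> (pos [x]) = word (layer x)"
  using iota_s iota_t by (cases x) (simp_all add: layer_def pos_gens o_def)

lemma layer_set: "set (layer x) \<subseteq> {1..m - 1}"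
  by (auto simp: layer_def)

lemma layer_split:
  assumes "odd \<tau> \<longleftrightarrow> x = Gen_s" "1 \<le> \<tau>" "\<tau> < m"
  obtains L1 L2 where "layer x = L1 @ \<tau> # L2" "set L1 \<subseteq> {1..\<tau> - 2}" "set L2 \<subseteq> {\<tau> + 2..m - 1}"
proof (cases x)
  case Gen_s
  with assms(1) obtain j where j: "\<tau> = 2 * j + 1" by (auto elim: oddE)
  with assms(3) have "[0..<k] = [0..<j] @ j # [Suc j..<k]"
    using upt_add_eq_append[of 0 j "k - j"] by (simp add: upt_conv_Cons)
  then have "layer x = map (\<lambda>i. 2 * i + 1) [0..<j] @ \<tau> # map (\<lambda>i. 2 * i + 1) [Suc j..<k]"
    by (simp add: layer_def Gen_s j)
  then show ?thesis by (rule that) (auto simp: j)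
next
  case Gen_t
  with assms(1) obtain j where j: "\<tau> = 2 * j" by (auto elim: evenE)
  with assms(2,3) have "[1..<k] = [1..<j] @ j # [Suc j..<k]"
    using upt_add_eq_append[of 1 j "k - j"] by (simp add: upt_conv_Cons)
  then have "layer x = map (\<lambda>i. 2 * i) [1..<j] @ \<tau> # map (\<lambda>i. 2 * i) [Suc j..<k]"
    by (simp add: layer_def Gen_t j)
  then show ?thesis by (rule that) (auto simp: j)
qed

text \<open>All indices in the layer have the parity of \<tau>, so \<tau> + 1 is absent, and this
  gap separates the two parts. For \<tau> = 0 the low part is trivial.\<close>

lemma layer_low_high:
  assumes "odd \<tau> \<longleftrightarrow> x = Gen_s" "\<tau> < m"
  obtains lo hi where "\<iota> (pos [x]) = lo \<odot> hi" "lo \<in> Sub {1..\<tau>}" "hi \<in> Sub {\<tau> + 2..m - 1}"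
proof (cases "\<tau> = 0")
  case True
  then have "set (layer x) \<subseteq> {\<tau> + 2..m - 1}" using assms by (auto simp: layer_def)
  then have hi: "word (layer x) \<in> Sub {\<tau> + 2..m - 1}" by (rule word_in_sub)
  then have "word (layer x) \<in> carrier B" by (rule sub_carrier) simp_all
  then show ?thesis using that[OF _ sub_one hi] by (simp add: layer_word)
next
  case False
  then obtain L1 L2 where L: "layer x = L1 @ \<tau> # L2" "set L1 \<subseteq> {1..\<tau> - 2}" "set L2 \<subseteq> {\<tau> + 2..m - 1}"
    using layer_split assms by (metis One_nat_def Suc_leI neq0_conv)
  show ?thesis
  proof (rule that)
    have "set (L1 @ [\<tau>]) \<subseteq> {1..m - 1}" "set L2 \<subseteq> {1..m - 1}" using layer_set[of x] L(1) by auto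
    then show "\<iota> (pos [x]) = word (L1 @ [\<tau>]) \<odot> word L2"
      unfolding layer_word L(1) by (subst word_append[symmetric]) simp_all
    have "set L1 \<subseteq> {1..\<tau>}" using L(2) by (rule subset_trans) auto
    then have "set (L1 @ [\<tau>]) \<subseteq> {1..\<tau>}" using False by simp
    then show "word (L1 @ [\<tau>]) \<in> Sub {1..\<tau>}" by (rule word_in_sub)
    show "word L2 \<in> Sub {\<tau> + 2..m - 1}" using L(3) by (rule word_in_sub)
  qed
qed

text \<open>Counting layers from the first \<open>s\<close>-block on, a letter \<open>r\<^sub>i\<close> of a layer \<open>\<tau> < i\<close> can be moved to the front,
  past every \<open>r\<^sub>1\<close>; \<open>cone c\<close> is the number of layers.\<close>
definition cone :: "I2_gen list \<Rightarrow> nat" where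
  "cone c = 2 * s_blocks c - (if c \<noteq> [] \<and> last c = Gen_s then 1 else 0)"

lemma s_blocks_pos: "c \<noteq> [] \<Longrightarrow> last c = Gen_s \<Longrightarrow> s_blocks c \<ge> 1"
  by (induction c) (auto split: if_splits)

text \<open>The parity of the cone identifies the newest layer, as \<open>layer_low_high\<close>
  requires. Letters t before the first s leave the cone at 0.\<close>

lemma cone_snoc: "cone c \<le> cone (c @ [x])" "odd (cone (c @ [x])) \<longleftrightarrow> x = Gen_s"
proof -
  have p: "s_blocks (c @ [x]) \<ge> 1" if "x = Gen_s" using s_blocks_pos[of "c @ [x]"] that by simp
  show "cone c \<le> cone (c @ [x])" using s_blocks_pos[of c] by (auto simp: cone_def s_blocks_snoc)
  show "odd (cone (c @ [x])) \<longleftrightarrow> x = Gen_s" using p by (auto simp: cone_def)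
qed

text \<open>When a letter is appended, the low part of its layer is absorbed into \<open>b\<close>.
  The high part has indices at least two beyond the cone, so it commutes with everything there and
  moves left into \<open>U\<close>.\<close>

lemma cone_decomposition:
  "cone c < m \<Longrightarrow> \<exists>a\<in>U. \<exists>b\<in>Sub {1..cone c}. \<iota> (pos c) = a \<odot> b"
proof (induction c rule: rev_induct)
  case Nil
  then show ?case using sub_one by (intro bexI[of _ "\<one>\<^bsub>B\<^esub>"]) simp_all
next
  case (snoc x c)
  let ?t = "cone (c @ [x])"
  have t: "?t \<le> m - 1" using snoc.prems by simp
  from snoc cone_snoc(1)[of c x] obtain a b where ab: "a \<in> U" "b \<in> Sub {1..cone c}" "\<iota> (pos c) = a \<odot> b"
    by fastforce
  obtain lo hi where lh: "\<iota> (pos [x]) = lo \<odot> hi" "lo \<in> Sub {1..?t}" "hi \<in> Sub {?t + 2..m - 1}"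
    using layer_low_high[OF cone_snoc(2) snoc.prems] by blast
  have b: "b \<in> Sub {1..?t}" by (rule sub_mono[OF ab(2)]) (simp_all add: cone_snoc(1))
  then have blo: "b \<odot> lo \<in> Sub {1..?t}" using lh(2) t by (intro sub_mult) simp_all
  have hi: "hi \<in> U" using lh(3) by (rule sub_mono) simp_all
  have com: "(b \<odot> lo) \<odot> hi = hi \<odot> (b \<odot> lo)"
    using blo lh(3) by (rule sub_commute) (use t in simp_all)
  have c: "a \<in> carrier B" "b \<in> carrier B" "lo \<in> carrier B" "hi \<in> carrier B"
    using ab(1) hi b lh(2) t by (auto elim!: sub_carrier)
  have "\<iota> (pos (c @ [x])) = a \<odot> ((b \<odot> lo) \<odot> hi)"
    using c by (simp add: pos_append ab(3) lh(1) braid.m_assoc)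
  also have "\<dots> = (a \<odot> hi) \<odot> (b \<odot> lo)" unfolding com using c by (simp add: braid.m_assoc)
  finally show ?case using blo sub_mult[OF ab(1) hi] by auto
qed

section \<open>The braid \<delta> and conjugation by it\<close>

definition delta :: "nat \<Rightarrow> nat word set" where
  "delta \<tau> = word [1..<Suc \<tau>]"

lemma delta_0 [simp]: "delta 0 = \<one>\<^bsub>B\<^esub>"
  by (simp add: delta_def)

lemma delta_Suc:
  assumes "Suc \<tau> < m"
  shows "delta (Suc \<tau>) = delta \<tau> \<odot> r (Suc \<tau>)"
proof -
  have "r (Suc \<tau>) \<in> carrier B" using assms by (intro braid_gen_closed) auto
  moreover have "[1..<Suc (Suc \<tau>)] = [1..<Suc \<tau>] @ [Suc \<tau>]" by simp
  moreover have "word ([1..<Suc \<tau>] @ [Suc \<tau>]) = word [1..<Suc \<tau>] \<odot> word [Suc \<tau>]"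
    by (rule word_append) (use assms in auto)
  ultimately show ?thesis by (simp add: delta_def del: upt_Suc)
qed

lemma delta_closed: "\<tau> < m \<Longrightarrow> delta \<tau> \<in> carrier B"
  unfolding delta_def by (rule braid_gen_list_closed) auto

lemma delta_sub: "delta \<tau> \<in> Sub {1..\<tau>}"
  unfolding delta_def by (rule word_in_sub) auto

text \<open>Refines the cone argument by tracking the tip of the cone in each layer: these letters
  r_1, r_2, ... assemble to \<open>delta\<close>. The old remainder \<open>q\<close> and the low
  part of the new layer stay at least two indices below the new tip, so they move to its
  right.\<close>

lemma Delta_cone:
  "\<tau> < m \<Longrightarrow> \<exists>a\<in>U. \<exists>q\<in>Sub {1..\<tau> - 1}. \<iota> (pos (alternating Gen_s Gen_t \<tau>)) = a \<odot> delta \<tau> \<odot> q"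
proof (induction \<tau>)
  case 0
  then show ?case using sub_one by (intro bexI[of _ "\<one>\<^bsub>B\<^esub>"]) simp_all
next
  case (Suc \<tau>)
  then obtain a q where aq: "a \<in> U" "q \<in> Sub {1..\<tau> - 1}" "\<iota> (pos (alternating Gen_s Gen_t \<tau>)) = a \<odot> delta \<tau> \<odot> q"
    by auto
  define x where "x = (if even \<tau> then Gen_s else Gen_t)"
  obtain L1 L2 where L: "layer x = L1 @ Suc \<tau> # L2" "set L1 \<subseteq> {1..Suc \<tau> - 2}" "set L2 \<subseteq> {Suc \<tau> + 2..m - 1}"
  proof (rule layer_split)
    show "odd (Suc \<tau>) \<longleftrightarrow> x = Gen_s" by (simp add: x_def)
  qed (use Suc.prems in simp_all)
  let ?lo = "word L1" and ?hi = "word L2" and ?g = "r (Suc \<tau>)" and ?d = "delta \<tau>"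
  have lo: "?lo \<in> Sub {1..\<tau> - 1}" using L(2) by (intro word_in_sub) simp
  have hi: "?hi \<in> Sub {Suc \<tau> + 2..m - 1}" using L(3) by (rule word_in_sub)
  have g: "?g \<in> Sub {Suc \<tau>..Suc \<tau>}" by (rule braid_sub_gen) simp
  have hiU: "?hi \<in> U" using hi by (rule sub_mono) simp_all
  have c: "a \<in> carrier B" "q \<in> carrier B" "?lo \<in> carrier B" "?hi \<in> carrier B" "?g \<in> carrier B" "?d \<in> carrier B"
    using aq(1,2) lo hi delta_closed Suc.prems by (auto elim!: sub_carrier intro!: braid_gen_closed)
  have qlo: "q \<odot> ?lo \<in> Sub {1..\<tau> - 1}" using aq(2) lo Suc.prems by (intro sub_mult) simp_all
  have com1: "(q \<odot> ?lo) \<odot> ?g = ?g \<odot> (q \<odot> ?lo)"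
  proof (cases "\<tau> = 0")
    case True
    \<comment> \<open>For \<tau> = 0 truncated subtraction spoils the gap that
      \<open>sub_commute\<close> asks for, but the index set is empty and the subgroup
      trivial.\<close>
    then have "q \<odot> ?lo \<in> generate B {}" using qlo by (simp add: braid_sub_def)
    then have "q \<odot> ?lo = \<one>\<^bsub>B\<^esub>" using braid.generate_empty by blast
    then show ?thesis using c by simp
  next
    case False
    show ?thesis using qlo g by (rule sub_commute) (use False Suc.prems in simp_all)
  qed
  have "?d \<odot> ?g \<odot> (q \<odot> ?lo) \<in> Sub {1..Suc \<tau>}"
    by (intro sub_mult sub_mono[OF delta_sub] sub_mono[OF g] sub_mono[OF qlo]) (use Suc.prems in simp_all)
  then have com2: "(?d \<odot> ?g \<odot> (q \<odot> ?lo)) \<odot> ?hi = ?hi \<odot> (?d \<odot> ?g \<odot> (q \<odot> ?lo))"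
    using hi by (rule sub_commute) (use Suc.prems in simp_all)
  have s: "set L1 \<subseteq> {1..m - 1}" "set (Suc \<tau> # L2) \<subseteq> {1..m - 1}" using layer_set[of x] unfolding L(1) by auto
  have "\<iota> (pos [x]) = ?lo \<odot> (?g \<odot> ?hi)"
    unfolding layer_word L(1) word_append[OF s] by simp
  then have "\<iota> (pos (alternating Gen_s Gen_t (Suc \<tau>))) = a \<odot> ?d \<odot> q \<odot> (?lo \<odot> (?g \<odot> ?hi))"
    unfolding alternating_snoc x_def[symmetric] pos_append using aq(3) by simp
  also have "\<dots> = a \<odot> (?d \<odot> ((q \<odot> ?lo) \<odot> ?g) \<odot> ?hi)" using c by (simp add: braid.m_assoc)
  also have "\<dots> = a \<odot> ((?d \<odot> ?g \<odot> (q \<odot> ?lo)) \<odot> ?hi)" unfolding com1 using c by (simp add: braid.m_assoc)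
  also have "\<dots> = (a \<odot> ?hi) \<odot> delta (Suc \<tau>) \<odot> (q \<odot> ?lo)"
    unfolding com2 delta_Suc[OF Suc.prems] using c by (simp add: braid.m_assoc)
  finally show ?case using qlo sub_mult[OF aq(1) hiU] sub_mono[OF qlo, of 1 "Suc \<tau> - 1"] by auto
qed

text \<open>When \<open>delta\<close> grows by a generator, that generator commutes with r_i unless
  their indices are adjacent. In the adjacent case the braid relation produces r_{i+1}, which
  commutes with the remaining shorter \<open>delta\<close>.\<close>

lemma delta_shift:
  "1 \<le> i \<Longrightarrow> i < \<tau> \<Longrightarrow> \<tau> < m \<Longrightarrow> delta \<tau> \<odot> r i = r (Suc i) \<odot> delta \<tau>"
proof (induction \<tau>)
  case (Suc \<tau>)
  have c: "delta \<tau> \<in> carrier B" "r i \<in> carrier B" "r (Suc i) \<in> carrier B" "r (Suc \<tau>) \<in> carrier B"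
    using Suc.prems delta_closed by (auto intro!: braid_gen_closed)
  show ?case
  proof (cases "i = \<tau>")
    case False
    then have "r (Suc \<tau>) \<odot> r i = r i \<odot> r (Suc \<tau>)" using Suc.prems by (intro braid_gen_commute) auto
    then have "delta (Suc \<tau>) \<odot> r i = delta \<tau> \<odot> r i \<odot> r (Suc \<tau>)"
      unfolding delta_Suc[OF Suc.prems(3)] using c by (simp add: braid.m_assoc)
    also have "\<dots> = r (Suc i) \<odot> delta (Suc \<tau>)"
      using Suc False c unfolding delta_Suc[OF Suc.prems(3)] by (simp add: braid.m_assoc)
    finally show ?thesis .
  next
    case True
    then obtain \<sigma> where \<sigma>: "\<tau> = Suc \<sigma>" "i = Suc \<sigma>" using Suc.prems by (cases \<tau>) auto
    let ?d = "delta \<sigma>"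
    have d: "delta (Suc \<tau>) = ?d \<odot> r i \<odot> r (Suc i)"
      using delta_Suc[of \<sigma>] delta_Suc[of \<tau>] Suc.prems \<sigma> by simp
    have d0: "?d \<in> carrier B" using Suc.prems \<sigma> by (intro delta_closed) simp
    have g: "r (Suc i) \<in> Sub {Suc i..Suc i}" by (rule braid_sub_gen) simp
    have com: "?d \<odot> r (Suc i) = r (Suc i) \<odot> ?d"
      using delta_sub g by (rule sub_commute) (use Suc.prems \<sigma> in simp_all)
    have br: "r i \<odot> (r (Suc i) \<odot> r i) = r (Suc i) \<odot> (r i \<odot> r (Suc i))"
      by (rule braid_gen_braid) (use Suc.prems \<sigma> in auto)
    have "delta (Suc \<tau>) \<odot> r i = ?d \<odot> (r i \<odot> (r (Suc i) \<odot> r i))" unfolding d using c d0 by (simp add: braid.m_assoc)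
    also have "\<dots> = (?d \<odot> r (Suc i)) \<odot> (r i \<odot> r (Suc i))" unfolding br using c d0 by (simp add: braid.m_assoc)
    also have "\<dots> = r (Suc i) \<odot> delta (Suc \<tau>)" unfolding com d using c d0 by (simp add: braid.m_assoc)
    finally show ?thesis .
  qed
qed simp

lemma delta_conj:
  assumes "v \<in> Sub {1..m - 2}"
  shows "delta (m - 1) \<odot> v \<odot> inv\<^bsub>B\<^esub> delta (m - 1) \<in> U"
proof (rule braid.conjugate_generate[OF _ _ _ _ assms[unfolded braid_sub_def]])
  show d: "delta (m - 1) \<in> carrier B" using k by (intro delta_closed) simp
  show "r ` {1..m - 2} \<subseteq> carrier B" using braid_gen_closed by fastforce
  show "subgroup U B" by (rule sub) simp_all
  fix y assume "y \<in> r ` {1..m - 2}"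
  then obtain i where i: "y = r i" "1 \<le> i" "i < m - 1" using k by auto
  have "r (Suc i) \<in> carrier B" using i by (intro braid_gen_closed) auto
  moreover have "delta (m - 1) \<odot> y = r (Suc i) \<odot> delta (m - 1)"
    unfolding i(1) by (rule delta_shift) (use i k in simp_all)
  ultimately have "delta (m - 1) \<odot> y \<odot> inv\<^bsub>B\<^esub> delta (m - 1) = r (Suc i)"
    using d by (simp add: braid.m_assoc)
  then show "delta (m - 1) \<odot> y \<odot> inv\<^bsub>B\<^esub> delta (m - 1) \<in> U"
    using braid_sub_gen[of "Suc i" "{2..m - 1}" m] i by auto
qed

section \<open>r_1-negative images and the equivalence\<close>

lemma negative_single:
  assumes "s_blocks c \<le> k - 1"
  shows "r1_negative m (\<iota> (pos c) \<odot> inv\<^bsub>B\<^esub> \<iota> \<Delta>)"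
proof -
  \<comment> \<open>With at most \<open>k - 1\<close> blocks the cone ends at
    \<open>2 * (k - 1)\<close>, so the last generator stays out of \<open>b\<close>.\<close>
  have "cone c \<le> m - 2" using assms by (auto simp: cone_def)
  moreover have "m - 2 < m" using k by simp
  ultimately obtain a b where ab: "a \<in> U" "b \<in> Sub {1..cone c}" "\<iota> (pos c) = a \<odot> b"
    using cone_decomposition[of c] by (meson le_less_trans)
  then have b: "b \<in> Sub {1..m - 2}" using \<open>cone c \<le> m - 2\<close> sub_mono by blast
  obtain a' q where aq: "a' \<in> U" "q \<in> Sub {1..m - 2}"
    "\<iota> (pos (alternating Gen_s Gen_t (m - 1))) = a' \<odot> delta (m - 1) \<odot> q"
    using Delta_cone[of "m - 1"] k by (auto simp: numeral_2_eq_2)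
  \<comment> \<open>The image of t has even indices up to \<open>2 * k - 2\<close> only, so the
    final t of \<Delta> can remain to the right of \<open>delta\<close>.\<close>
  have "set (layer Gen_t) \<subseteq> {1..m - 2}" by (auto simp: layer_def)
  then have t: "word (layer Gen_t) \<in> Sub {1..m - 2}" by (rule word_in_sub)
  define v where "v = b \<odot> inv\<^bsub>B\<^esub> (q \<odot> word (layer Gen_t))"
  have v: "v \<in> Sub {1..m - 2}"
    unfolding v_def using b aq(2) t by (intro sub_mult sub_inv) simp_all
  let ?d = "delta (m - 1)"
  define u where "u = ?d \<odot> v \<odot> inv\<^bsub>B\<^esub> ?d"
  have u: "u \<in> U" unfolding u_def using v by (rule delta_conj)
  let ?d' = "word [2..<m]"
  have d': "?d' \<in> U" by (rule word_in_sub) auto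
  have c: "a \<in> carrier B" "b \<in> carrier B" "a' \<in> carrier B" "q \<in> carrier B" "word (layer Gen_t) \<in> carrier B"
    "v \<in> carrier B" "u \<in> carrier B" "?d' \<in> carrier B" "r 1 \<in> carrier B"
    using ab(1) b aq(1,2) t v u d' gen1[OF m2] by (auto elim!: sub_carrier)
  \<comment> \<open>The generator r_1 occurs just once in \<open>delta\<close>, and the other
    letters lie in \<open>U\<close>. This is the source of the single r_1^{-1}.\<close>
  have "[1..<Suc (m - 1)] = 1 # [2..<m]" using k by (simp add: upt_conv_Cons numeral_2_eq_2)
  then have d: "?d = r 1 \<odot> ?d'" by (simp add: delta_def)
  have dc: "?d \<in> carrier B" unfolding d using c by simp
  \<comment> \<open>Carrying \<open>v\<close> across the inverse of \<open>delta\<close> raises its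
    indices by one, so it no longer involves r_1.\<close>
  have vd: "v \<odot> inv\<^bsub>B\<^esub> ?d = inv\<^bsub>B\<^esub> ?d \<odot> u"
    unfolding u_def using c dc by (simp add: braid.m_assoc braid.inv_cancel_left)
  have "\<iota> \<Delta> = a' \<odot> ?d \<odot> (q \<odot> word (layer Gen_t))"
  proof -
    have "\<Delta> = pos (alternating Gen_s Gen_t (m - 1)) \<cdot> pos [Gen_t]"
      using alt_m(2)[of Gen_s] Delta_eq[of Gen_s] by (simp only: pos_append other.simps)
    then have "\<iota> \<Delta> = a' \<odot> ?d \<odot> q \<odot> word (layer Gen_t)"
      unfolding aq(3)[symmetric] layer_word[symmetric] by (simp only: iota.hom_mult pos_closed)
    then show ?thesis using c dc by (simp add: braid.m_assoc)
  qed
  then have "\<iota> (pos c) \<odot> inv\<^bsub>B\<^esub> \<iota> \<Delta> = a \<odot> (v \<odot> inv\<^bsub>B\<^esub> ?d) \<odot> inv\<^bsub>B\<^esub> a'"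
    unfolding ab(3) v_def using c dc by (simp add: braid.m_assoc braid.inv_mult_group)
  also have "\<dots> = (a \<odot> inv\<^bsub>B\<^esub> ?d') \<odot> inv\<^bsub>B\<^esub> r 1 \<odot> (u \<odot> inv\<^bsub>B\<^esub> a')"
    unfolding vd unfolding d using c by (simp add: braid.m_assoc braid.inv_mult_group)
  finally show ?thesis
    using r1_negative_base[OF m2, of "a \<odot> inv\<^bsub>B\<^esub> ?d'" "u \<odot> inv\<^bsub>B\<^esub> a'"]
      sub_mult[OF ab(1) sub_inv[OF d']] sub_mult[OF u sub_inv[OF aq(1)]] by simp
qed

text \<open>By centrality each of \<open>l\<close> pieces of the word receives its own
  \<Delta>^{-1}, and r_1-negative braids are closed under products.\<close>

lemma negative_pow:
  assumes "l \<ge> 1" "s_blocks c \<le> l * (k - 1)"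
  shows "r1_negative m (\<iota> (pos c \<cdot> (\<Delta> [^]\<^bsub>G\<^esub> (- int l))))"
  using assms
proof (induction l arbitrary: c rule: nat_induct_at_least)
  case base
  then show ?case using negative_single[of c] G.int_pow_neg[of \<Delta> 1] by simp
next
  case (Suc l)
  from Suc.prems have "s_blocks c \<le> (k - 1) + l * (k - 1)" by simp
  then obtain c1 c2 where c: "c = c1 @ c2" "s_blocks c1 \<le> k - 1" "s_blocks c2 \<le> l * (k - 1)"
    by (rule s_blocks_split)
  let ?D = "\<Delta> [^]\<^bsub>G\<^esub> (- int l)"
  have "\<Delta> [^]\<^bsub>G\<^esub> (- int (Suc l)) = \<Delta> [^]\<^bsub>G\<^esub> (- 1 :: int) \<cdot> ?D"
    using G.int_pow_mult[of \<Delta> "- 1" "- int l"] by simp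
  then have "pos c \<cdot> (\<Delta> [^]\<^bsub>G\<^esub> (- int (Suc l))) = pos c1 \<cdot> (pos c2 \<cdot> (\<Delta> [^]\<^bsub>G\<^esub> (- 1 :: int))) \<cdot> ?D"
    unfolding c(1) pos_append by (simp add: G.m_assoc)
  also have "\<dots> = (pos c1 \<cdot> inv\<^bsub>G\<^esub> \<Delta>) \<cdot> (pos c2 \<cdot> ?D)"
  proof -
    have "pos c2 \<cdot> (\<Delta> [^]\<^bsub>G\<^esub> (- 1 :: int)) = inv\<^bsub>G\<^esub> \<Delta> \<cdot> pos c2"
      using Delta_pow_central[of "pos c2" "- 1"] G.int_pow_neg[of \<Delta> 1] by simp
    then show ?thesis by (simp add: G.m_assoc)
  qed
  finally have "\<iota> (pos c \<cdot> (\<Delta> [^]\<^bsub>G\<^esub> (- int (Suc l)))) = (\<iota> (pos c1) \<odot> inv\<^bsub>B\<^esub> \<iota> \<Delta>) \<odot> \<iota> (pos c2 \<cdot> ?D)"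
    by simp
  then show ?case using r1_negative_mult[OF m2 negative_single[OF c(2)] Suc.IH[OF c(3)]] by simp
qed

lemma iota_pos: "\<exists>is. set is \<subseteq> {1..m - 1} \<and> \<iota> (pos w) = word is"
proof (induction w)
  case Nil
  then show ?case by (intro exI[of _ "[]"]) simp
next
  case (Cons x w)
  then obtain "is" where "is": "set is \<subseteq> {1..m - 1}" "\<iota> (pos w) = word is" by blast
  have "\<iota> (pos (x # w)) = \<iota> (pos [x]) \<odot> \<iota> (pos w)" unfolding pos_Cons[of x w] by simp
  also have "\<dots> = word (layer x @ is)"
    unfolding layer_word "is"(2) word_append[OF layer_set "is"(1)] ..
  finally show ?case using "is"(1) layer_set[of x] by (intro exI[of _ "layer x @ is"]) simp
qed

lemma iota_no_s: "s_blocks w = 0 \<Longrightarrow> \<iota> (pos w) \<in> U"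
proof (induction w)
  case (Cons x w)
  have "x \<noteq> Gen_s" using s_blocks_pos[of "rev (x # w)"] Cons.prems s_blocks_rev[of "x # w"] by auto
  then have x: "x = Gen_t" "s_blocks w = 0" using Cons.prems by (cases x; simp)+
  have "set (layer x) \<subseteq> {2..m - 1}" by (auto simp: x(1) layer_def)
  then have "\<iota> (pos [x]) \<in> U" unfolding layer_word by (rule word_in_sub)
  moreover have "\<iota> (pos (x # w)) = \<iota> (pos [x]) \<odot> \<iota> (pos w)" unfolding pos_Cons[of x w] by simp
  ultimately show ?case using Cons.IH[OF x(2)] sub_mult by simp
qed (simp add: sub_one)

lemma negative_iff:
  assumes \<alpha>: "\<alpha> \<in> carrier G"
  shows "H_G1_negative G (artin_M m) \<Delta> (artin_M1 m) (artin_N m) \<alpha> \<longleftrightarrow> r1_negative m (\<iota> \<alpha>)"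
proof
  assume "H_G1_negative G (artin_M m) \<Delta> (artin_M1 m) (artin_N m) \<alpha>"
  then obtain a j where aj: "unmovable G (artin_M m) \<Delta> a" "\<alpha> = a \<cdot> (\<Delta> [^]\<^bsub>G\<^esub> (- j :: int))" "j \<ge> 1"
    "depth a < depth (\<Delta> [^]\<^bsub>G\<^esub> j)"
    unfolding H_G1_negative_def Delta_form_def by blast
  from aj(1) obtain w where w: "a = pos w" unfolding unmovable_def M_eq by blast
  have "depth a = s_blocks w" using aj(1) unfolding w by (intro depth_reduced unmovable_reduced)
  then have "s_blocks w \<le> nat j * (k - 1)" using aj(3,4) by (simp add: depth_Delta_pow)
  from negative_pow[OF _ this] show "r1_negative m (\<iota> \<alpha>)" using aj(2,3) w by simp
next
  assume neg: "r1_negative m (\<iota> \<alpha>)"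
  obtain w i where w: "reduced m w" "\<alpha> = pos w \<cdot> (\<Delta> [^]\<^bsub>G\<^esub> (i :: int))" "unmovable G (artin_M m) \<Delta> (pos w)"
    using exists_Delta_form[OF \<alpha>] .
  have "i < 0"
  proof (rule ccontr)
    assume "\<not> i < 0"
    \<comment> \<open>A nonnegative exponent makes \<alpha> positive, and hence its image a positive
      braid.\<close>
    then have "\<alpha> = pos (w @ t_complement (nat i) @ replicate (nat i) Gen_t)"
      using w(2) Delta_pow[of "nat i"] by (simp add: pos_append)
    then obtain "is" where "set is \<subseteq> {1..m - 1}" "\<iota> \<alpha> = word is" using iota_pos by blast
    then show False using not_r1_negative(2)[OF m2] neg by metis
  qed
  define j where "j = nat (- i)"
  have j: "j \<ge> 1" "i = - int j" using \<open>i < 0\<close> by (simp_all add: j_def)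
  show "H_G1_negative G (artin_M m) \<Delta> (artin_M1 m) (artin_N m) \<alpha>"
  proof (rule ccontr)
    assume "\<not> ?thesis"
    then have "\<not> depth (pos w) < depth (\<Delta> [^]\<^bsub>G\<^esub> int j)"
      unfolding H_G1_negative_def Delta_form_def using w(2,3) j by auto
    then have sw: "s_blocks w \<ge> j * (k - 1) + 1"
      using depth_reduced[OF w(1)] depth_Delta_pow[of "int j"] j(1) by simp
    then have "rev w \<noteq> []" by auto
    then obtain y v where yv: "rev w = y # v" by (cases "rev w") auto
    then have yv': "rev (y # v) = w" by (metis rev_rev_ident)
    have "reduced m (y # v)" using w(1) yv reduced_rev by metis
    from complement[OF this] obtain l c where c: "inv\<^bsub>G\<^esub> pos w = pos c \<cdot> (\<Delta> [^]\<^bsub>G\<^esub> (- int l))"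
      "s_blocks (y # v) + s_blocks c = l * (k - 1) + 1" unfolding yv' by blast
    have sb: "s_blocks w + s_blocks c = l * (k - 1) + 1" using c(2) yv s_blocks_rev by metis
    have "inv\<^bsub>G\<^esub> \<alpha> = inv\<^bsub>G\<^esub> (\<Delta> [^]\<^bsub>G\<^esub> i) \<cdot> inv\<^bsub>G\<^esub> pos w"
      unfolding w(2) by (rule G.inv_mult_group) simp_all
    also have "inv\<^bsub>G\<^esub> (\<Delta> [^]\<^bsub>G\<^esub> i) = \<Delta> [^]\<^bsub>G\<^esub> int j"
      using G.int_pow_neg[of \<Delta> i] j(2) by simp
    also have "\<dots> \<cdot> inv\<^bsub>G\<^esub> pos w = pos c \<cdot> (\<Delta> [^]\<^bsub>G\<^esub> int j \<cdot> (\<Delta> [^]\<^bsub>G\<^esub> (- int l)))"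
      unfolding c(1) using Delta_pow_central[of "pos c" "int j"] by (simp flip: G.m_assoc)
    also have "\<dots> = pos c \<cdot> (\<Delta> [^]\<^bsub>G\<^esub> (int j - int l))"
      using G.int_pow_mult[of \<Delta> "int j" "- int l"] by simp
    finally have inv: "inv\<^bsub>G\<^esub> \<alpha> = pos c \<cdot> (\<Delta> [^]\<^bsub>G\<^esub> (int j - int l))" .
    have ia: "inv\<^bsub>B\<^esub> \<iota> \<alpha> = \<iota> (inv\<^bsub>G\<^esub> \<alpha>)" "\<iota> \<alpha> \<in> carrier B" using \<alpha> by simp_all
    show False
    proof (cases "j < l")
      case True
      \<comment> \<open>The block balance leaves \<open>c\<close> at most
        \<open>(l - j) * (k - 1)\<close> blocks, so the inverse of \<alpha> already has an
        r_1-negative image.\<close>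
      have "l * (k - 1) = j * (k - 1) + (l - j) * (k - 1)"
        using True by (simp flip: add_mult_distrib)
      then have "s_blocks c \<le> (l - j) * (k - 1)" using sb sw by linarith
      from negative_pow[OF _ this] True have "r1_negative m (\<iota> (inv\<^bsub>G\<^esub> \<alpha>))"
        by (simp add: inv of_nat_diff)
      then show False using not_r1_negative(3)[OF m2 _ ia(2)] ia(1) neg by simp
    next
      case False
      \<comment> \<open>Now \<open>w\<close> alone uses up the whole block balance: \<open>c\<close>
        contains no s, and \<open>k \<ge> 2\<close> forces \<open>l = j\<close>. So the inverse of
        \<alpha> is a power of t, whose image lies in \<open>U\<close>.\<close>
      then have lj: "j * (k - 1) = l * (k - 1) + (j - l) * (k - 1)"
        by (simp flip: add_mult_distrib)
      then have "(j - l) * (k - 1) = 0" "s_blocks c = 0" using sb sw by linarith+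
      then have "l = j" using k False by auto
      then have "inv\<^bsub>G\<^esub> \<alpha> = pos c" using inv by simp
      then have "\<iota> (inv\<^bsub>G\<^esub> \<alpha>) \<in> U" using iota_no_s[OF \<open>s_blocks c = 0\<close>] by simp
      then have "inv\<^bsub>B\<^esub> (inv\<^bsub>B\<^esub> \<iota> \<alpha>) \<in> U" unfolding ia(1)[symmetric] by (rule sub_inv) simp_all
      then have "\<iota> \<alpha> \<in> U" using ia(2) by simp
      then show False using not_r1_negative(1)[OF m2] neg by blast
    qed
  qed
qed

end

theorem proposition5p4:
  fixes m k :: nat
    and \<iota> :: "I2_gen word set \<Rightarrow> nat word set"
    and \<alpha> :: "I2_gen word set"
  assumes "m = 2 * k" and "m \<ge> 4"
    and "\<iota> \<in> hom (artin_I2 m) (braid_group (2 * k))"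
    and "\<iota> (artin_s m) =
           list_prod (braid_group (2 * k)) (map (\<lambda>i. braid_gen (2 * k) (2 * i + 1)) [0..<k])"
    and "\<iota> (artin_t m) =
           list_prod (braid_group (2 * k)) (map (\<lambda>i. braid_gen (2 * k) (2 * i)) [1..<k])"
    and "\<alpha> \<in> carrier (artin_I2 m)"
  shows "H_G1_negative (artin_I2 m) (artin_M m) (artin_Delta m) (artin_M1 m) (artin_N m) \<alpha>
           \<longleftrightarrow> r1_negative (2 * k) (\<iota> \<alpha>)"
proof -
  interpret dihedral_braid k \<iota>
    using assms by unfold_locales simp_all
  show ?thesis using negative_iff assms(1,6) by simp
qed

end
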